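(* For every integer $k\geq 2$ and every odd integer $q\geq 5$, there exists $n_1(k,q)\in\mathbb{N}$ such that for all $n\geq n_1(k,q)$ we have $$\mathrm{ex}(n,C_{k,q})=e(T_{n,2})+(k-1)^2,$$ and the only extremal graphs for $C_{k,q}$ on $n$ vertices are the members of $\mathcal{F}_{n,k}$; that is, a $C_{k,q}$-free graph on $n$ vertices has $\mathrm{ex}(n,C_{k,q})$ edges if and only if it is (isomorphic to) a member of $\mathcal{F}_{n,k}$.
   Context: All graphs are finite and simple; $e(G)$ is the number of edges of $G$. A graph $G$ is $H$-free if it does not contain $H$ as a (not necessarily induced) subgraph. $\mathrm{ex}(n,H)$ is the maximum number of edges of an $H$-free graph on $n$ vertices, and an extremal graph for $H$ on $n$ vertices is an $H$-free graph on $n$ vertices with $\mathrm{ex}(n,H)$ edges. $T_{n,2}$ is the Turán graph, i.e. the complete bipartite graph on $n$ vertices with part sizes $\lfloor n/2\rfloor$ and $\lceil n/2\rceil$. A $q$-cycle is a cycle of length $q$. For a positive integer $k$ and an odd integer $q\geq 5$, $C_{k,q}$ is the graph consisting of $k$ $q$-cycles which intersect in exactly one common vertex (so the cycles all share one vertex, called the center, and are otherwise pairwise vertex-disjoint; it has $k(q-1)+1$ vertices). For $n\geq 4(k-1)^2$, $\mathcal{F}_{n,k}$ is the family of graphs each member of which is a Turán graph $T_{n,2}$ with a complete bipartite graph $K_{k-1,k-1}$ embedded into one of its two classes; i.e. one takes $T_{n,2}$, chooses two disjoint $(k-1)$-element subsets $A,B$ of one of its two classes, and adds all edges between $A$ and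 $B$. *)

theory Defs
  imports Main
begin

type_synonym 'a graph = "'a set \<times> 'a set set"

abbreviation vertices :: "'a graph \<Rightarrow> 'a set" where
  "vertices \<equiv> fst"

abbreviation edges :: "'a graph \<Rightarrow> 'a set set" where
  "edges \<equiv> snd"

definition simple_graph :: "'a graph \<Rightarrow> bool" where
  "simple_graph G \<longleftrightarrow> finite (vertices G) \<and>
     (\<forall>e\<in>edges G. e \<subseteq> vertices G \<and> card e = 2)"

definition num_edges :: "'a graph \<Rightarrow> nat" where
  "num_edges G = card (edges G)"

definition graph_iso :: "'a graph \<Rightarrow> 'b graph \<Rightarrow> bool" where
  "graph_iso G H \<longleftrightarrow>
     (\<exists>f. bij_betw f (vertices G) (vertices H) \<and> (\<lambda>e. f ` e) ` edges G = edges H)"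

text \<open>Subgraphs are not required to be induced.\<close>

definition contains_subgraph :: "'a graph \<Rightarrow> 'b graph \<Rightarrow> bool" where
  "contains_subgraph G H \<longleftrightarrow>
     (\<exists>f. inj_on f (vertices H) \<and> f ` vertices H \<subseteq> vertices G \<and>
          (\<forall>e\<in>edges H. f ` e \<in> edges G))"

definition graph_free :: "'b graph \<Rightarrow> 'a graph \<Rightarrow> bool" where
  "graph_free H G \<longleftrightarrow> \<not> contains_subgraph G H"

text \<open>Every finite graph is isomorphic to one with vertices in \<^typ>\<open>nat\<close>, so the maximum may be
  taken over those. The set is finite, and it is nonempty as soon as \<open>H\<close> has an edge.\<close>

definition ex_number :: "nat \<Rightarrow> 'b graph \<Rightarrow> nat" where
  "ex_number n H =
     Max {num_edges G | G :: nat graph.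
            simple_graph G \<and> card (vertices G) = n \<and> graph_free H G}"

definition extremal_graph :: "nat \<Rightarrow> 'b graph \<Rightarrow> 'a graph \<Rightarrow> bool" where
  "extremal_graph n H G \<longleftrightarrow>
     simple_graph G \<and> card (vertices G) = n \<and> graph_free H G \<and> num_edges G = ex_number n H"

definition bip_edges :: "'a set \<Rightarrow> 'a set \<Rightarrow> 'a set set" where
  "bip_edges A B = {{a, b} | a b. a \<in> A \<and> b \<in> B}"

definition turan_left :: "nat \<Rightarrow> nat set" where
  "turan_left n = {..<n div 2}"

definition turan_right :: "nat \<Rightarrow> nat set" where
  "turan_right n = {n div 2..<n}"

definition turan2 :: "nat \<Rightarrow> nat graph" where
  "turan2 n = (turan_left n \<union> turan_right n, bip_edges (turan_left n) (turan_right n))"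

text \<open>The \<open>j\<close>-th vertex of the \<open>i\<close>-th cycle, for \<open>i < k\<close> and \<open>j < q\<close>; position 0 of every cycle
  is the common center \<open>(0, 0)\<close>.\<close>

definition cyc_vertex :: "nat \<Rightarrow> nat \<Rightarrow> nat \<times> nat" where
  "cyc_vertex i j = (if j = 0 then (0, 0) else (i, j))"

definition cycles_graph :: "nat \<Rightarrow> nat \<Rightarrow> (nat \<times> nat) graph" where
  "cycles_graph k q =
     ({cyc_vertex i j | i j. i < k \<and> j < q},
      {{cyc_vertex i j, cyc_vertex i (Suc j mod q)} | i j. i < k \<and> j < q})"

text \<open>All graphs on the fixed vertex set of \<^term>\<open>turan2 n\<close> obtained by adding a complete bipartite
  graph inside one class; the family is meant up to isomorphism, and for \<open>n \<ge> 4 (k - 1)\<^sup>2\<close>.\<close>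

definition turan_family :: "nat \<Rightarrow> nat \<Rightarrow> nat graph set" where
  "turan_family n k =
     {(vertices (turan2 n), edges (turan2 n) \<union> bip_edges A B) | A B.
        (A \<union> B \<subseteq> turan_left n \<or> A \<union> B \<subseteq> turan_right n) \<and> A \<inter> B = {} \<and>
        card A = k - 1 \<and> card B = k - 1}"

end

theory Submission
  imports Defs
begin

text \<open>Why the theorem holds. Put \<open>D = k - 1\<close> and split the vertex set of a graph into two sides
  \<open>P\<close> and \<open>Q\<close>. Call an edge inside a side \<^emph>\<open>inner\<close>, and call a pair across the sides that is not an
  edge \<^emph>\<open>missed\<close>. The number of edges is \<open>|P| |Q|\<close> plus the number of inner edges minus the number
  of missed pairs. So the theorem comes down to this: for a suitable partition, inner edges outnumber
  missed pairs by at most \<open>D\<^sup>2\<close>, and by exactly \<open>D\<^sup>2\<close> only if nothing is missed and the inner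
  edges form a \<open>K\<^bsub>D,D\<^esub>\<close>.

  \<^bold>\<open>Routing.\<close> Call two disjoint sides linked if any two vertices of one side have many common
  neighbours in the other. Two vertices of one side are then joined by a path of each even
  length between 2 and \<open>q\<close>, and such a path can avoid any small set. Since \<open>q \<ge> 5\<close> is odd, an inner edge at \<open>v\<close>
  lies on a \<open>q\<close>-cycle through \<open>v\<close>. So does an inner edge \<open>xy\<close> off \<open>v\<close>, provided it lies on the
  side of \<open>v\<close> or has an end adjacent to \<open>v\<close>; call such an edge usable at \<open>v\<close>. Cycles obtained from
  disjoint inner edges can be chosen greedily so that they meet only in \<open>v\<close>. Hence in a
  \<open>C\<^bsub>k,q\<^esub>\<close>-free graph, the star of inner edges at \<open>v\<close> and a matching of usable inner edges off that
  star have at most \<open>D\<close> edges together (\<open>star_matching_flower\<close>).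

  \<^bold>\<open>Counting.\<close> Let \<open>d\<close> and \<open>m\<close> count the inner neighbours and the missed partners of a vertex, and
  choose \<open>v\<close> maximising \<open>2 d - m\<close>. Put \<open>s = d v\<close> and \<open>\<mu> = m v\<close>, and let \<open>r\<close> be the size of a
  maximal usable matching off the star at \<open>v\<close>, so that \<open>s + r \<le> D\<close>. Every inner edge meets the
  \<open>s + 2 r\<close> vertices that are inner neighbours of \<open>v\<close> or matched, except for edges among the \<open>\<mu>\<close>
  vertices missed by \<open>v\<close>. Distributing the edges and the missed pairs over these vertices bounds
  four times the difference of inner edges and missed pairs by
  \<open>(2 s + 4 r + \<mu>) (2 s - \<mu>) = 4 (s + r)\<^sup>2 - 4 r\<^sup>2 - 4 r \<mu> - \<mu>\<^sup>2 \<le> 4 D\<^sup>2\<close>. Equality forces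
  \<open>r = \<mu> = 0\<close> and \<open>s = D\<close>, and then the structure (\<open>surplus_le\<close>, \<open>surplus_extremal\<close>).

  \<^bold>\<open>The partition.\<close> A large graph of minimum degree at least \<open>\<lfloor>n/2\<rfloor>\<close> contains a complete bipartite
  graph with large classes \<open>A\<close>, \<open>B\<close>, by pigeonhole. No vertex has many neighbours in both classes,
  for it would be the centre of a copy of \<open>C\<^bsub>k,q\<^esub>\<close>. Comparing with the degree sum over \<open>A \<union> B\<close>, all
  but few vertices are adjacent to most of \<open>A\<close> or to most of \<open>B\<close>. These two sets of vertices become
  independent after removing boundedly many vertices, and then the minimum degree makes them
  linked; each remaining vertex joins the side in which it has few neighbours
  (\<open>linked_partition\<close>).

  \<^bold>\<open>Minimum degree.\<close> Deleting a vertex of degree below \<open>\<lfloor>n/2\<rfloor>\<close> increases the excess of the number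
  of edges over that of the Turan graph. The excess is at most quadratic in the order, so a large
  graph cannot lose vertices in this way for long, and for large \<open>n\<close> an extremal graph has none to
  lose (\<open>upper_bound\<close>).

  \<^bold>\<open>Members of the family are free.\<close> Each odd cycle has an edge inside a class, so it meets both
  sides of the embedded \<open>K\<^bsub>D,D\<^esub>\<close>. One of those sides avoids the centre, and it has too few vertices
  for \<open>k\<close> cycles that are disjoint outside the centre (\<open>turan_family_free\<close>).\<close>

section \<open>Finite counting\<close>

lemma ex_outside:
  assumes "finite F" "card F < card S"
  shows "\<exists>z\<in>S. z \<notin> F"
  using assms by (meson card_mono leD subsetI)

lemma sum_card_swap:
  assumes "finite A" "finite B"
  shows "(\<Sum>x\<in>A. card {y\<in>B. R x y}) = (\<Sum>y\<in>B. card {x\<in>A. R x y})"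
  using sum_multicount_gen[of A B R "\<lambda>y. card {x\<in>A. R x y}"] assms by simp

lemma sum_eq_bound_imp_eq:
  fixes f :: "'a \<Rightarrow> nat"
  assumes "finite K" "\<And>x. x \<in> K \<Longrightarrow> f x \<le> c" "card K * c \<le> sum f K" "x \<in> K"
  shows "f x = c"
proof (rule ccontr)
  assume "f x \<noteq> c"
  then have "f x < c" using assms by (simp add: order_less_le)
  then have "sum f K < (\<Sum>x\<in>K. c)"
    using assms by (intro sum_strict_mono_ex1) auto
  then show False using assms by simp
qed

lemma card_common_lower:
  assumes "finite A" "d \<le> card (S \<inter> A)" "d \<le> card (S' \<inter> A)" "card A + L \<le> 2 * d"
  shows "L \<le> card (S \<inter> S' \<inter> A)"
proof -
  have "card (S \<inter> A) + card (S' \<inter> A) = card ((S \<inter> A) \<union> (S' \<inter> A)) + card ((S \<inter> A) \<inter> (S' \<inter> A))"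
    using assms(1) by (intro card_Un_Int) auto
  moreover have "card ((S \<inter> A) \<union> (S' \<inter> A)) \<le> card A"
    using assms(1) by (intro card_mono) auto
  moreover have "(S \<inter> A) \<inter> (S' \<inter> A) = S \<inter> S' \<inter> A" by auto
  ultimately show ?thesis using assms(2-4) by simp
qed

text \<open>If \<open>b = a + e + g\<close> with \<open>e \<le> g \<le> e + 1\<close>, the balanced product is \<open>(a + e) (a + g) = a b + e g\<close>,
  and \<open>e g = 0\<close> only if \<open>e = 0\<close>.\<close>

lemma half_product_max:
  fixes a b :: nat
  shows "a * b \<le> ((a + b) div 2) * (a + b - (a + b) div 2)"
    and "a * b = ((a + b) div 2) * (a + b - (a + b) div 2) \<Longrightarrow> a = (a + b) div 2 \<or> b = (a + b) div 2"
proof -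
  have main: "a * b \<le> ((a + b) div 2) * (a + b - (a + b) div 2) \<and>
     (a * b = ((a + b) div 2) * (a + b - (a + b) div 2) \<longrightarrow> a = (a + b) div 2)"
    if "a \<le> b" for a b :: nat
  proof -
    define e where "e = (b - a) div 2"
    define g where "g = b - a - e"
    have half: "(a + b) div 2 = a + e" "a + b - (a + e) = a + g" and b: "b = a + e + g" and "e \<le> g"
      using that unfolding g_def e_def by linarith+
    have "(a + e) * (a + g) = a * b + e * g" unfolding b by (simp add: algebra_simps)
    then show ?thesis unfolding half using \<open>e \<le> g\<close> by auto
  qed
  show "a * b \<le> ((a + b) div 2) * (a + b - (a + b) div 2)"
    using main[of a b] main[of b a] by (cases "a \<le> b") (simp_all add: ac_simps)
  show "a = (a + b) div 2 \<or> b = (a + b) div 2"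
    if "a * b = ((a + b) div 2) * (a + b - (a + b) div 2)"
    using main[of a b] main[of b a] that by (cases "a \<le> b") (simp_all add: ac_simps)
qed

text \<open>The arithmetic behind the constant \<open>D\<^sup>2\<close>: the product on the right equals
  \<open>4 (s + r)\<^sup>2 - (4 r\<^sup>2 + 4 r \<mu> + \<mu>\<^sup>2)\<close>.\<close>

lemma surplus_estimate_eval:
  fixes s r \<mu> D' S :: int
  assumes "2 * S \<le> (2 * s + 4 * r + \<mu>) * (2 * s - \<mu>)" "s + r \<le> D'" "0 \<le> s" "0 \<le> r" "0 \<le> \<mu>"
  shows "S \<le> 2 * D'\<^sup>2" "S = 2 * D'\<^sup>2 \<Longrightarrow> r = 0 \<and> \<mu> = 0 \<and> s = D'"
proof -
  have e: "(2 * s + 4 * r + \<mu>) * (2 * s - \<mu>) = 4 * (s + r)\<^sup>2 - (4 * r\<^sup>2 + 4 * (r * \<mu>) + \<mu>\<^sup>2)"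
    by (simp add: power2_eq_square algebra_simps)
  have sq: "(s + r)\<^sup>2 \<le> D'\<^sup>2" using assms by (intro power_mono) auto
  have nn: "0 \<le> r\<^sup>2" "0 \<le> r * \<mu>" "0 \<le> \<mu>\<^sup>2" using assms by auto
  show "S \<le> 2 * D'\<^sup>2" using assms(1) sq nn unfolding e by linarith
  assume "S = 2 * D'\<^sup>2"
  then have "r\<^sup>2 = 0" "\<mu>\<^sup>2 = 0" "(s + r)\<^sup>2 = D'\<^sup>2" using assms(1) sq nn unfolding e by linarith+
  then show "r = 0 \<and> \<mu> = 0 \<and> s = D'" using assms by auto
qed

section \<open>Cycles through a vertex in a linked pair of sides\<close>

text \<open>The combinatorial part works with an adjacency relation, which makes neighbourhoods and walks
  easier to write than sets of two-element edges do.\<close>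

locale ugraph =
  fixes V :: "'a set" and adj :: "'a \<Rightarrow> 'a \<Rightarrow> bool"
  assumes finite_V: "finite V"
    and adj_sym: "adj x y \<Longrightarrow> adj y x"
    and adj_irrefl: "\<not> adj x x"
    and adj_V: "adj x y \<Longrightarrow> x \<in> V"
begin

definition nbrs :: "'a \<Rightarrow> 'a set" where
  "nbrs x = {y. adj x y}"

lemma nbrs_subset: "nbrs x \<subseteq> V"
  using adj_sym adj_V by (auto simp: nbrs_def)

lemma finite_nbrs [simp]: "finite (nbrs x)"
  using nbrs_subset finite_V finite_subset by blast

text \<open>One \<open>q\<close>-cycle through \<open>c\<close>, given by the list of its other vertices in cyclic order.\<close>

definition petal :: "nat \<Rightarrow> 'a \<Rightarrow> 'a list \<Rightarrow> bool" where
  "petal q c p \<longleftrightarrow> length p = q - 1 \<and> distinct p \<and> c \<notin> set p \<and> successively adj (c # p @ [c])"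

text \<open>A copy of the graph of \<open>k\<close> cycles of length \<open>q\<close> that share exactly their centre.\<close>

definition flower :: "nat \<Rightarrow> nat \<Rightarrow> bool" where
  "flower k q \<longleftrightarrow> (\<exists>c p. (\<forall>i<k. petal q c (p i)) \<and>
     (\<forall>i<k. \<forall>j<k. i \<noteq> j \<longrightarrow> set (p i) \<inter> set (p j) = {}))"

text \<open>The two vertices may coincide, so that the condition also bounds degrees across from below.
  Common neighbours are all that routing needs.\<close>

definition linked :: "'a set \<Rightarrow> 'a set \<Rightarrow> nat \<Rightarrow> bool" where
  "linked P Q L \<longleftrightarrow> P \<inter> Q = {} \<and>
     (\<forall>x\<in>P. \<forall>y\<in>P. L \<le> card (nbrs x \<inter> nbrs y \<inter> Q)) \<and>
     (\<forall>x\<in>Q. \<forall>y\<in>Q. L \<le> card (nbrs x \<inter> nbrs y \<inter> P))"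

lemma linked_sym: "linked P Q L \<Longrightarrow> linked Q P L"
  by (auto simp: linked_def)

lemma linked_common:
  assumes "linked P Q L" "x \<in> P" "y \<in> P" "finite F" "card F < L"
  shows "\<exists>z\<in>Q. adj x z \<and> adj z y \<and> z \<notin> F"
proof -
  have "card F < card (nbrs x \<inter> nbrs y \<inter> Q)"
    using assms by (auto simp: linked_def intro: less_le_trans)
  from ex_outside[OF assms(4) this] show ?thesis
    using adj_sym by (auto simp: nbrs_def)
qed

text \<open>A step of length two, to a neighbour of \<open>x\<close> and on to a fresh vertex of \<open>P\<close>, shortens the path
  to be found; the vertices used up are added to the forbidden set \<open>F\<close>, which the term \<open>2 * j\<close>
  pays for.\<close>

lemma even_path:
  assumes lk: "linked P Q L"
  shows "x \<in> P \<Longrightarrow> y \<in> P \<Longrightarrow> x \<noteq> y \<Longrightarrow> finite F \<Longrightarrow> card F + 2 * j + 4 \<le> L \<Longrightarrow>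
    \<exists>p. length p = 2 * j + 1 \<and> distinct p \<and> set p \<inter> insert x (insert y F) = {} \<and>
        successively adj (x # p @ [y])"
proof (induction j arbitrary: x F)
  case 0
  from 0 linked_common[OF lk 0(1,2,4)] obtain z where z: "z \<in> Q" "adj x z" "adj z y" "z \<notin> F"
    by auto
  then show ?case using adj_irrefl by (intro exI[of _ "[z]"]) auto
next
  case (Suc j)
  obtain z where z: "z \<in> Q" "adj x z" "z \<notin> F"
    using Suc.prems linked_common[OF lk Suc.prems(1) Suc.prems(1) Suc.prems(4)] by auto
  have cF: "card (insert x (insert y F)) \<le> card F + 2"
    using Suc.prems(4) by (simp add: card_insert_if)
  obtain w where w: "w \<in> P" "adj z w" "w \<notin> F" "w \<noteq> x" "w \<noteq> y"
    using linked_common[OF linked_sym[OF lk] z(1) z(1), of "insert x (insert y F)"] Suc.prems cF by auto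
  have cF2: "card (insert x (insert z F)) \<le> card F + 2"
    using Suc.prems(4) by (simp add: card_insert_if)
  have zP: "z \<noteq> y" "z \<noteq> x" "z \<noteq> w" using z w lk Suc.prems by (auto simp: linked_def)
  obtain p where p: "length p = 2 * j + 1" "distinct p"
    "set p \<inter> insert w (insert y (insert x (insert z F))) = {}" "successively adj (w # p @ [y])"
    using Suc.IH[OF w(1) Suc.prems(2) w(5), of "insert x (insert z F)"] Suc.prems cF2 by auto
  show ?case
    using p z w zP by (intro exI[of _ "z # w # p"]) auto
qed

context
  fixes P Q :: "'a set" and L q :: nat
  assumes lk: "linked P Q L" and q5: "5 \<le> q" and oddq: "odd q"
begin

lemma odd_length: "\<exists>j. q = 2 * j + 5"
  using q5 oddq by presburger

lemma petal_at_leaf: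
  assumes "u \<in> P" "v \<in> P" "adj v u" "finite F" "card F + q + 4 \<le> L" "u \<notin> F"
  shows "\<exists>p. petal q v p \<and> set p \<inter> F = {}"
proof -
  obtain j where j: "q = 2 * j + 3"
    using odd_length that[of "Suc _"] by auto
  have "u \<noteq> v" using assms adj_irrefl by auto
  then obtain p where p: "length p = 2 * j + 1" "distinct p" "set p \<inter> insert u (insert v F) = {}"
      "successively adj (u # p @ [v])"
    using even_path[OF lk assms(1,2) _ assms(4), of j] assms(5) j by auto
  then show ?thesis using assms \<open>u \<noteq> v\<close> j
    by (intro exI[of _ "u # p"]) (auto simp: petal_def)
qed

text \<open>The cycle runs from \<open>v\<close> through a common neighbour of \<open>v\<close> and \<open>x\<close>, along \<open>x y\<close>, and back by an even path.\<close>

lemma petal_through_edge: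
  assumes "x \<in> P" "y \<in> P" "v \<in> P" "adj x y" "v \<noteq> x" "v \<noteq> y" "finite F" "card F + q + 4 \<le> L"
    "x \<notin> F" "y \<notin> F"
  shows "\<exists>p. petal q v p \<and> set p \<inter> F = {}"
proof -
  obtain j where j: "q = 2 * j + 5"
    using odd_length by auto
  have xy: "x \<noteq> y" using assms adj_irrefl by auto
  obtain w where w: "w \<in> Q" "adj v w" "adj w x" "w \<notin> F"
    using linked_common[OF lk assms(3,1,7)] assms(8) by auto
  have c: "card (insert w (insert x F)) \<le> card F + 2"
    using assms by (simp add: card_insert_if)
  have wP: "w \<noteq> v" "w \<noteq> x" "w \<noteq> y" using w lk assms by (auto simp: linked_def)
  obtain p where "length p = 2 * j + 1" "distinct p"
      "set p \<inter> insert y (insert v (insert w (insert x F))) = {}" "successively adj (y # p @ [v])"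
    using even_path[OF lk assms(2,3), of "insert w (insert x F)" j] assms(7,8) assms(6) c j by auto
  then show ?thesis using assms w wP xy j
    by (intro exI[of _ "w # x # y # p"]) (auto simp: petal_def)
qed

text \<open>When \<open>v\<close> lies across from the edge \<open>x y\<close>, parity leaves no room for a detour at both ends if
  \<open>q = 5\<close>: one end of the edge has to be adjacent to \<open>v\<close> itself. This is why missed pairs matter in
  the counting below.\<close>

lemma petal_through_opposite_edge:
  assumes "x \<in> Q" "y \<in> Q" "v \<in> P" "adj x y" "adj v x" "finite F" "card F + q + 4 \<le> L"
    "x \<notin> F" "y \<notin> F"
  shows "\<exists>p. petal q v p \<and> set p \<inter> F = {}"
proof -
  obtain j where j: "q = 2 * j + 5"
    using odd_length by auto
  have xy: "x \<noteq> y" using assms adj_irrefl by auto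
  have c0: "card (insert y (insert x F)) \<le> card F + 2"
    using assms by (simp add: card_insert_if)
  obtain w where w: "w \<in> Q" "adj v w" "w \<notin> F" "w \<noteq> x" "w \<noteq> y"
    using linked_common[OF lk assms(3,3), of "insert y (insert x F)"] assms(6,7) c0 by auto
  have c: "card (insert v (insert x F)) \<le> card F + 2"
    using assms by (simp add: card_insert_if)
  have wP: "w \<noteq> v" "x \<noteq> v" "y \<noteq> v" using w lk assms by (auto simp: linked_def)
  obtain p where "length p = 2 * j + 1" "distinct p"
      "set p \<inter> insert y (insert w (insert v (insert x F))) = {}" "successively adj (y # p @ [w])"
    using even_path[OF linked_sym[OF lk] assms(2) w(1), of "insert v (insert x F)" j] assms(6,7) w c j by auto
  then show ?thesis using assms w wP xy j adj_sym
    by (intro exI[of _ "x # y # p @ [w]"]) (auto simp: petal_def successively_append_iff successively_Cons hd_append)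
qed

text \<open>This is what assigns a vertex outside both sides to one of them: in a graph without flowers it
  cannot have many neighbours in both.\<close>

lemma petal_two_sided:
  assumes "L \<le> card (nbrs v \<inter> P)" "L \<le> card (nbrs v \<inter> Q)" "finite F" "card F + q + 4 \<le> L"
  shows "\<exists>p. petal q v p \<and> set p \<inter> F = {}"
proof -
  obtain j where j: "q = 2 * j + 5"
    using odd_length by auto
  obtain a where a: "a \<in> P" "adj v a" "a \<notin> F"
    using ex_outside[OF assms(3), of "nbrs v \<inter> P"] assms by (auto simp: nbrs_def)
  obtain b where b: "b \<in> Q" "adj v b" "b \<notin> F"
    using ex_outside[OF assms(3), of "nbrs v \<inter> Q"] assms by (auto simp: nbrs_def)
  have c0: "card (insert v (insert b F)) \<le> card F + 2" "card (insert a (insert v F)) \<le> card F + 2"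
    using assms by (simp_all add: card_insert_if)
  obtain w where w: "w \<in> Q" "adj a w" "w \<notin> F" "w \<noteq> v" "w \<noteq> b"
    using linked_common[OF lk a(1) a(1), of "insert v (insert b F)"] assms c0 by auto
  have ne: "a \<noteq> v" "b \<noteq> v" "a \<noteq> b" "a \<noteq> w" using a b w adj_irrefl lk by (auto simp: linked_def)
  obtain p where "length p = 2 * j + 1" "distinct p"
      "set p \<inter> insert w (insert b (insert a (insert v F))) = {}" "successively adj (w # p @ [b])"
    using even_path[OF linked_sym[OF lk] w(1) b(1), of "insert a (insert v F)" j] assms w c0 j by auto
  then show ?thesis using a b w ne j adj_sym
    by (intro exI[of _ "a # w # p @ [b]"]) (auto simp: petal_def successively_append_iff successively_Cons hd_append)
qed

end

text \<open>Greedy choice: the \<open>i\<close>-th cycle avoids the cycles already chosen and the seeds of the later ones,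
  at most \<open>k * q\<close> vertices altogether. A seed \<open>S i\<close> is what the \<open>i\<close>-th cycle needs to find still
  unused.\<close>

lemma flower_from_seeds:
  fixes S :: "nat \<Rightarrow> 'a set"
  assumes disj: "\<And>i j. i < k \<Longrightarrow> j < k \<Longrightarrow> i \<noteq> j \<Longrightarrow> S i \<inter> S j = {}"
    and small: "\<And>i. i < k \<Longrightarrow> finite (S i) \<and> card (S i) < q \<and> c \<notin> S i"
    and petals: "\<And>i F. i < k \<Longrightarrow> finite F \<Longrightarrow> card F \<le> k * q \<Longrightarrow> F \<inter> S i = {} \<Longrightarrow> c \<notin> F \<Longrightarrow>
          \<exists>p. petal q c p \<and> set p \<inter> F = {}"
  shows "flower k q"
proof -
  have "i \<le> k \<Longrightarrow> \<exists>p. (\<forall>j<i. petal q c (p j) \<and> (\<forall>l<k. i \<le> l \<longrightarrow> set (p j) \<inter> S l = {})) \<and>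
     (\<forall>j<i. \<forall>l<i. j \<noteq> l \<longrightarrow> set (p j) \<inter> set (p l) = {})" for i
  proof (induction i)
    case 0 then show ?case by auto
  next
    case (Suc i)
    then have "\<exists>p. (\<forall>j<i. petal q c (p j) \<and> (\<forall>l<k. i \<le> l \<longrightarrow> set (p j) \<inter> S l = {})) \<and>
       (\<forall>j<i. \<forall>l<i. j \<noteq> l \<longrightarrow> set (p j) \<inter> set (p l) = {})" by simp
    then obtain p where p: "\<And>j. j < i \<Longrightarrow> petal q c (p j)"
       "\<And>j l. j < i \<Longrightarrow> l < k \<Longrightarrow> i \<le> l \<Longrightarrow> set (p j) \<inter> S l = {}"
       "\<And>j l. j < i \<Longrightarrow> l < i \<Longrightarrow> j \<noteq> l \<Longrightarrow> set (p j) \<inter> set (p l) = {}" by metis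
    define F where "F = (\<Union>j\<in>{..<k}. if j < i then set (p j) else if j = i then {} else S j)"
    have fin: "finite F" using small by (auto simp: F_def)
    have len: "card (set (p j)) \<le> q" if "j < i" for j
      using card_length[of "p j"] p(1)[OF that] by (auto simp: petal_def)
    have "card F \<le> (\<Sum>j\<in>{..<k}. card (if j < i then set (p j) else if j = i then {} else S j))"
      unfolding F_def by (rule card_UN_le) auto
    also have "\<dots> \<le> (\<Sum>j\<in>{..<k}. q)"
      using len small by (intro sum_mono) (auto simp: less_imp_le)
    finally have cF: "card F \<le> k * q" by simp
    have FS: "F \<inter> S i = {}" using p(2)[of _ i] disj[of _ i] Suc.prems
      by (auto simp: F_def split: if_splits)
    have cn: "c \<notin> F" using p(1) small by (auto simp: F_def petal_def split: if_splits)
    obtain r where r: "petal q c r" "set r \<inter> F = {}"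
      using petals[of i F] Suc.prems fin cF FS cn by auto
    have r1: "set r \<inter> set (p j) = {}" if "j < i" for j
      using r(2) that Suc.prems unfolding F_def by (auto simp: disjoint_iff)
    have r2: "set r \<inter> S l = {}" if "Suc i \<le> l" "l < k" for l
      using r(2) that Suc.prems unfolding F_def by (auto simp: disjoint_iff)
    show ?case
    proof (intro exI[of _ "p(i := r)"] conjI allI impI)
      fix j l assume "j < Suc i" "l < Suc i" "j \<noteq> l"
      then show "set ((p(i := r)) j) \<inter> set ((p(i := r)) l) = {}"
        using r1[of j] r1[of l] p(3)[of j l] by (auto simp: less_Suc_eq)
    next
      fix j l assume "j < Suc i" "l < k" "Suc i \<le> l"
      then show "set ((p(i := r)) j) \<inter> S l = {}"
        using r2[of l] p(2)[of j l] by (auto simp: less_Suc_eq)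
    qed (use p(1) r(1) in \<open>auto simp: less_Suc_eq\<close>)
  qed
  from this[OF order_refl] obtain p where p:
    "\<forall>j<k. petal q c (p j) \<and> (\<forall>l<k. k \<le> l \<longrightarrow> set (p j) \<inter> S l = {})"
    "\<forall>j<k. \<forall>l<k. j \<noteq> l \<longrightarrow> set (p j) \<inter> set (p l) = {}" by (elim exE conjE)
  show ?thesis unfolding flower_def
    by (intro exI[of _ c] exI[of _ p] conjI p(2)) (simp add: p(1))
qed

text \<open>The seeds are the leaves of the star and the edges of the matching.\<close>

lemma star_matching_flower:
  assumes lk: "linked P Q L" and L: "k * q + q + 4 \<le> L" and q: "5 \<le> q" "odd q"
    and v: "v \<in> P" and St: "St \<subseteq> nbrs v \<inter> P"
    and M: "finite M" "pairwise disjnt M"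
    and edge: "\<And>e. e \<in> M \<Longrightarrow> \<exists>x y. e = {x, y} \<and> adj x y \<and> v \<notin> e \<and> e \<inter> St = {} \<and>
        (x \<in> P \<and> y \<in> P \<or> x \<in> Q \<and> y \<in> Q \<and> adj v x)"
    and k: "k \<le> card St + card M"
  shows "flower k q"
proof -
  have finSt: "finite St" using St finite_nbrs finite_subset by blast
  define \<S> where "\<S> = (\<lambda>u. {u}) ` St \<union> M"
  have card2: "card e = 2" if eM: "e \<in> M" for e
  proof -
    obtain x y where "e = {x, y}" "adj x y" using edge[OF eM] by blast
    then show ?thesis using adj_irrefl[of x] by (cases "x = y") auto
  qed
  have "(\<lambda>u. {u}) ` St \<inter> M = {}" using card2 by fastforce
  then have "card \<S> = card St + card M"
    using M(1) finSt by (simp add: \<S>_def card_Un_disjoint card_image)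
  moreover have finS: "finite \<S>" using M(1) finSt by (simp add: \<S>_def)
  ultimately obtain h where h: "bij_betw h {0..<card St + card M} \<S>"
    using ex_bij_betw_nat_finite by metis
  have hS: "h i \<in> \<S>" if "i < k" for i using h k that by (auto simp: bij_betw_def)
  have disjS: "e \<inter> e' = {}" if ee: "e \<in> \<S>" "e' \<in> \<S>" "e \<noteq> e'" for e e'
  proof -
    have st: "u \<notin> e" if eM: "e \<in> M" and u: "u \<in> St" for u e
    proof -
      have "e \<inter> St = {}" using edge[OF eM] by metis
      then show ?thesis using u by auto
    qed
    have mm: "a \<inter> b = {}" if "a \<in> M" "b \<in> M" "a \<noteq> b" for a b
      using pairwiseD[OF M(2) that] by (simp add: disjnt_def)
    consider "e \<in> M" "e' \<in> M" | u where "u \<in> St" "e = {u}" "e' \<in> M"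
      | u where "u \<in> St" "e' = {u}" "e \<in> M" | u u' where "e = {u}" "e' = {u'}"
      using ee(1,2) unfolding \<S>_def by blast
    then show ?thesis
      by cases (use st mm ee(3) in auto)
  qed
  have vSt: "v \<notin> St"
    using St adj_irrefl[of v] unfolding nbrs_def by blast
  show ?thesis
  proof (rule flower_from_seeds[of k h q v])
    fix i j assume ij: "i < k" "j < k" "i \<noteq> j"
    then have "h i \<noteq> h j" using inj_onD[OF bij_betw_imp_inj_on[OF h], of i j] k by auto
    then show "h i \<inter> h j = {}" using disjS[OF hS hS, of i j] ij by simp
  next
    fix i assume "i < k"
    from hS[OF this] consider u where "u \<in> St" "h i = {u}" | "h i \<in> M"
      unfolding \<S>_def by blast
    then show "finite (h i) \<and> card (h i) < q \<and> v \<notin> h i"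
    proof cases
      case 2
      have "v \<notin> h i" using edge[OF 2] by metis
      then show ?thesis using card2[OF 2] q card.infinite[of "h i"] by linarith
    qed (use q vSt in auto)
  next
    fix i F assume F: "i < k" "finite F" "card F \<le> k * q" "F \<inter> h i = {}" "v \<notin> F"
    have cF: "card F + q + 4 \<le> L" using F L by simp
    from hS[OF F(1)] consider (leaf) u where "u \<in> St" "h i = {u}" | (edge) "h i \<in> M"
      unfolding \<S>_def by blast
    then show "\<exists>p. petal q v p \<and> set p \<inter> F = {}"
    proof cases
      case leaf
      then show ?thesis using petal_at_leaf[OF lk q, of u v F] St v F cF by (auto simp: nbrs_def)
    next
      case edge
      obtain x y where e: "h i = {x, y}" "adj x y" "v \<notin> h i"
         "x \<in> P \<and> y \<in> P \<or> x \<in> Q \<and> y \<in> Q \<and> adj v x" using assms(9)[OF edge] by blast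
      show ?thesis
      proof (cases "x \<in> P \<and> y \<in> P")
        case True
        then show ?thesis using petal_through_edge[OF lk q, of x y v F] e F v cF by auto
      next
        case False
        then show ?thesis using petal_through_opposite_edge[OF lk q, of x y v F] e F v cF by auto
      qed
    qed
  qed
qed

end

section \<open>Inner edges against missed pairs\<close>

locale cut_graph = ugraph +
  fixes P Q :: "'a set" and D :: nat
  assumes V_eq: "V = P \<union> Q" and PQ: "P \<inter> Q = {}"
begin

definition same :: "'a \<Rightarrow> 'a \<Rightarrow> bool" where
  "same x y \<longleftrightarrow> (x \<in> P \<longleftrightarrow> y \<in> P)"

definition inner :: "'a \<Rightarrow> 'a set" where
  "inner x = {y. adj x y \<and> same x y}"

definition missed :: "'a \<Rightarrow> 'a set" where
  "missed x = {y \<in> V. \<not> same x y \<and> \<not> adj x y}"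

text \<open>The matchings that complete the star of inner edges at \<open>v\<close> to a family of cycles through \<open>v\<close>: see
  \<open>star_matching_flower\<close>.\<close>

definition usable_matching :: "'a \<Rightarrow> 'a set set \<Rightarrow> bool" where
  "usable_matching v M \<longleftrightarrow> pairwise disjnt M \<and>
     (\<forall>e\<in>M. \<exists>x y. e = {x, y} \<and> adj x y \<and> same x y \<and> e \<inter> insert v (inner v) = {} \<and>
        (same v x \<or> adj v x))"

lemma inner_subset: "inner x \<subseteq> V" using nbrs_subset by (auto simp: inner_def nbrs_def)
lemma finite_inner [simp]: "finite (inner x)" using inner_subset finite_V finite_subset by blast
lemma finite_missed [simp]: "finite (missed x)" using finite_V by (simp add: missed_def)
lemma inner_sym: "y \<in> inner x \<longleftrightarrow> x \<in> inner y" using adj_sym by (auto simp: inner_def same_def)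

lemma usable_matchingD:
  assumes "usable_matching v M" "e \<in> M"
  obtains x y where "e = {x, y}" "adj x y" "same x y" "e \<inter> insert v (inner v) = {}"
    "same v x \<or> adj v x"
  using assms unfolding usable_matching_def by metis

lemma usable_matching_subset:
  assumes M: "usable_matching v M"
  shows "M \<subseteq> Pow V"
proof
  fix e assume "e \<in> M"
  then obtain x y where "e = {x, y}" "adj x y" by (rule usable_matchingD[OF M])
  then show "e \<in> Pow V" using adj_V[of x y] adj_V[OF adj_sym, of x y] by simp
qed

lemma usable_matching_finite: "usable_matching v M \<Longrightarrow> finite M"
  using usable_matching_subset finite_V finite_subset by (metis finite_Pow_iff)

text \<open>The ratio \<open>2 : 1\<close> makes the bound below \<open>(2 s + 4 r + \<mu>) (2 s - \<mu>)\<close>, in which the terms with \<open>s \<mu>\<close>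
  cancel; here \<open>s\<close>, \<open>\<mu>\<close> and \<open>r\<close> count the inner neighbours of \<open>v\<close>, its missed partners and the
  edges of the matching.\<close>

definition weight :: "'a \<Rightarrow> int" where
  "weight x = 2 * int (card (inner x)) - int (card (missed x))"

text \<open>Twice the difference between the number of inner edges and the number of missed pairs.\<close>

definition surplus :: int where
  "surplus = (\<Sum>x\<in>V. int (card (inner x)) - int (card (missed x)))"

definition star_matching_bounded :: bool where
  "star_matching_bounded \<longleftrightarrow> (\<forall>v\<in>V. \<forall>M. usable_matching v M \<longrightarrow> card (inner v) + card M \<le> D)"

text \<open>Inner edges are counted by ordered pairs. Those from outside \<open>K\<close> into \<open>K\<close> are counted from their
  end in \<open>K\<close>.\<close>

lemma inner_degree_split:
  assumes "K \<subseteq> V"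
  shows "(\<Sum>x\<in>V. card (inner x)) = (\<Sum>x\<in>K. card (inner x) + card (inner x - K)) +
     (\<Sum>x\<in>V - K. card (inner x - K))"
proof -
  have finK: "finite K" using assms finite_V finite_subset by blast
  have "(\<Sum>x\<in>V. card (inner x)) = (\<Sum>x\<in>K. card (inner x)) + (\<Sum>x\<in>V-K. card (inner x))"
    using sum.subset_diff[OF assms finite_V, of "\<lambda>x. card (inner x)"] by simp
  also have "(\<Sum>x\<in>V-K. card (inner x)) = (\<Sum>x\<in>V-K. card (inner x - K) + card {y\<in>K. y \<in> inner x})"
  proof (rule sum.cong)
    fix x
    have "inner x = (inner x - K) \<union> {y\<in>K. y \<in> inner x}" by auto
    moreover have "card ((inner x - K) \<union> {y\<in>K. y \<in> inner x}) = card (inner x - K) + card {y\<in>K. y \<in> inner x}"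
      by (rule card_Un_disjoint) (use finK in auto)
    ultimately show "card (inner x) = card (inner x - K) + card {y\<in>K. y \<in> inner x}" by simp
  qed simp
  also have "\<dots> = (\<Sum>x\<in>V-K. card (inner x - K)) + (\<Sum>y\<in>K. card {x\<in>V-K. y \<in> inner x})"
    using sum_card_swap[of "V-K" K] finK finite_V by (simp add: sum.distrib)
  also have "(\<Sum>y\<in>K. card {x\<in>V-K. y \<in> inner x}) = (\<Sum>y\<in>K. card (inner y - K))"
  proof (rule sum.cong)
    fix y
    have "{x\<in>V-K. y \<in> inner x} = inner y - K" using inner_sym inner_subset by blast
    then show "card {x\<in>V-K. y \<in> inner x} = card (inner y - K)" by simp
  qed simp
  finally show ?thesis by (simp add: sum.distrib)
qed

text \<open>The only inner edges that avoid \<open>K\<close> are those at which \<open>v\<close> misses both ends: the condition applies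
  to \<open>y\<close> as well, by symmetry.\<close>

definition edges_dominated :: "'a \<Rightarrow> 'a set \<Rightarrow> bool" where
  "edges_dominated v K \<longleftrightarrow>
     (\<forall>x y. adj x y \<longrightarrow> same x y \<longrightarrow> x \<notin> K \<longrightarrow> y \<notin> K \<longrightarrow> x \<in> missed v)"

lemma max_weight_exists:
  assumes "V \<noteq> {}"
  shows "\<exists>v\<in>V. \<forall>x\<in>V. weight x \<le> weight v"
proof -
  have "Max (weight ` V) \<in> weight ` V" using assms finite_V by simp
  then obtain v where "v \<in> V" "weight v = Max (weight ` V)" by (metis imageE)
  then show ?thesis using finite_V by (intro bexI[of _ v]) auto
qed

text \<open>The estimate by a vertex of maximal weight needs that weight to be nonnegative; this disposes of the other case.\<close>

lemma surplus_negative_weights: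
  assumes "\<And>x. x \<in> V \<Longrightarrow> weight x \<le> 0"
  shows "surplus \<le> 0"
proof -
  have "2 * surplus = (\<Sum>x\<in>V. 2 * (int (card (inner x)) - int (card (missed x))))"
    by (simp add: surplus_def sum_distrib_left)
  also have "\<dots> \<le> (\<Sum>x\<in>V. 0)" using assms by (intro sum_mono) (force simp: weight_def)
  finally show ?thesis by simp
qed

context
  assumes bounded: "star_matching_bounded"
begin

lemma bounded_star: "v \<in> V \<Longrightarrow> usable_matching v M \<Longrightarrow> card (inner v) + card M \<le> D"
  using bounded unfolding star_matching_bounded_def by blast

lemma maximal_usable_matching:
  assumes v: "v \<in> V"
  obtains M where "usable_matching v M" "card (inner v) + card M \<le> D"
    "edges_dominated v (inner v \<union> \<Union>M)"
proof -
  have "usable_matching v {}" by (simp add: usable_matching_def)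
  moreover have "card M \<le> D" if "usable_matching v M" for M
    using bounded_star[OF v that] by linarith
  then have "\<forall>M. usable_matching v M \<longrightarrow> card M < Suc D" by (simp add: less_Suc_eq_le)
  ultimately obtain M where M: "usable_matching v M" "\<And>M'. usable_matching v M' \<Longrightarrow> card M' \<le> card M"
    using ex_has_greatest_nat[of "usable_matching v" "{}" card] by blast
  show ?thesis
  proof (rule that[OF M(1)])
    show "card (inner v) + card M \<le> D" by (rule bounded_star[OF v M(1)])
  next
    show "edges_dominated v (inner v \<union> \<Union>M)" unfolding edges_dominated_def
    proof (intro allI impI)
      fix x y assume xy: "adj x y" "same x y" "x \<notin> inner v \<union> \<Union>M" "y \<notin> inner v \<union> \<Union>M"
      show "x \<in> missed v"
      proof (rule ccontr)
        assume nm: "x \<notin> missed v"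
        have "x \<in> V" using xy adj_V by auto
        then have a: "same v x \<or> adj v x" using nm by (auto simp: missed_def)
        have ne: "v \<noteq> x" "v \<noteq> y"
          using xy adj_sym by (auto simp: inner_def same_def)
        have "usable_matching v (insert {x, y} M)"
          unfolding usable_matching_def
        proof (intro conjI ballI)
          show "pairwise disjnt (insert {x, y} M)"
            using M(1) xy(3,4) unfolding usable_matching_def pairwise_insert disjnt_def by auto
        next
          fix e assume "e \<in> insert {x, y} M"
          then show "\<exists>x y. e = {x, y} \<and> adj x y \<and> same x y \<and> e \<inter> insert v (inner v) = {} \<and> (same v x \<or> adj v x)"
          proof
            assume "e = {x, y}"
            then show ?thesis using xy a ne by (intro exI[of _ x] exI[of _ y]) auto
          next
            assume "e \<in> M"
            then show ?thesis using M(1) by (simp add: usable_matching_def)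
          qed
        qed
        from M(2)[OF this] have "card (insert {x, y} M) \<le> card M" .
        moreover have "{x, y} \<notin> M" using xy(3) by auto
        ultimately show False using usable_matching_finite[OF M(1)] by simp
      qed
    qed
  qed
qed

text \<open>With \<open>K\<close> the inner neighbours of \<open>v\<close> and the matched vertices, and \<open>R\<close> the vertices missed by \<open>v\<close>
  outside \<open>K\<close>, inner degrees sum to at most twice their sum over \<open>K\<close> plus their sum over \<open>R\<close>. Subtracting
  all missed partners of the vertices of \<open>K\<close> and half of those of the vertices of \<open>R\<close>, each vertex of
  \<open>K\<close> contributes its weight and each vertex of \<open>R\<close> half its weight, and no weight exceeds that of \<open>v\<close>.\<close>

lemma surplus_estimate:
  assumes v: "v \<in> V" and max: "\<forall>x\<in>V. weight x \<le> weight v" and pos: "0 \<le> weight v"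
  obtains M where "usable_matching v M" "card (inner v) + card M \<le> D"
    "2 * surplus \<le> (2 * int (card (inner v)) + 4 * int (card M) + int (card (missed v))) * weight v"
    "edges_dominated v (inner v \<union> \<Union>M)"
proof -
  obtain M where M: "usable_matching v M" "card (inner v) + card M \<le> D"
    "edges_dominated v (inner v \<union> \<Union>M)"
    by (rule maximal_usable_matching[OF v])
  have finM: "finite M" using usable_matching_finite[OF M(1)] .
  define K where "K = inner v \<union> \<Union>M"
  define R where "R = missed v - K"
  have MV: "\<Union>M \<subseteq> V" using usable_matching_subset[OF M(1)] by blast
  have KV: "K \<subseteq> V" using MV inner_subset by (auto simp: K_def)
  have RV: "R \<subseteq> V - K" by (auto simp: R_def missed_def)
  have finK: "finite K" and finR: "finite R" using KV finite_V finite_subset by (blast, simp add: R_def)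
  have "card (\<Union>M) \<le> (\<Sum>e\<in>M. card e)" by (rule card_Union_le_sum_card)
  also have "\<dots> \<le> (\<Sum>e\<in>M. 2)"
  proof (rule sum_mono)
    fix e assume "e \<in> M"
    then obtain x y where "e = {x, y}" by (rule usable_matchingD[OF M(1)])
    then show "card e \<le> 2" by (simp add: card_insert_if)
  qed
  finally have "card (\<Union>M) \<le> 2 * card M" by simp
  then have cK: "card K \<le> card (inner v) + 2 * card M"
    using card_Un_le[of "inner v" "\<Union>M"] by (simp add: K_def)
  have cR: "card R \<le> card (missed v)" unfolding R_def by (intro card_mono) auto
  have "(\<Sum>x\<in>V - K. card (inner x - K)) = (\<Sum>x\<in>R. card (inner x - K))"
  proof (rule sum.mono_neutral_right)
    have dom: "x \<in> missed v" if "adj x y" "same x y" "x \<notin> K" "y \<notin> K" for x y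
      using M(3) that unfolding edges_dominated_def K_def[symmetric] by blast
    show "\<forall>x\<in>V - K - R. card (inner x - K) = 0"
    proof
      fix x assume "x \<in> V - K - R"
      then have "inner x - K = {}" using dom[of x] by (auto simp: R_def inner_def)
      then show "card (inner x - K) = 0" by (metis card.empty)
    qed
  qed (use RV finite_V in auto)
  also have "\<dots> \<le> (\<Sum>x\<in>R. card (inner x))" by (intro sum_mono card_mono) auto
  finally have r: "(\<Sum>x\<in>V - K. card (inner x - K)) \<le> (\<Sum>x\<in>R. card (inner x))" .
  have "(\<Sum>x\<in>K. card (inner x) + card (inner x - K)) \<le> (\<Sum>x\<in>K. 2 * card (inner x))"
    by (intro sum_mono) (simp add: card_mono)
  with r inner_degree_split[OF KV]
  have deg: "(\<Sum>x\<in>V. card (inner x)) \<le> (\<Sum>x\<in>K. 2 * card (inner x)) + (\<Sum>x\<in>R. card (inner x))"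
    by linarith
  have "(\<Sum>x\<in>K. card (missed x)) + (\<Sum>x\<in>R. card (missed x)) = (\<Sum>x\<in>K \<union> R. card (missed x))"
    using finK finR RV by (subst sum.union_disjoint) auto
  also have "\<dots> \<le> (\<Sum>x\<in>V. card (missed x))"
    using finite_V KV RV by (intro sum_mono2) auto
  finally have mis: "(\<Sum>x\<in>K. card (missed x)) + (\<Sum>x\<in>R. card (missed x)) \<le> (\<Sum>x\<in>V. card (missed x))" .
  have s: "surplus = int (\<Sum>x\<in>V. card (inner x)) - int (\<Sum>x\<in>V. card (missed x))"
    by (simp add: surplus_def sum_subtractf)
  have wK: "(\<Sum>x\<in>K. weight x) = 2 * int (\<Sum>x\<in>K. card (inner x)) - int (\<Sum>x\<in>K. card (missed x))"
    by (simp add: weight_def sum_subtractf sum_distrib_left)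
  have wR: "(\<Sum>x\<in>R. weight x) = 2 * int (\<Sum>x\<in>R. card (inner x)) - int (\<Sum>x\<in>R. card (missed x))"
    by (simp add: weight_def sum_subtractf sum_distrib_left)
  have "(\<Sum>x\<in>K. weight x) \<le> (\<Sum>x\<in>K. weight v)" using max KV by (intro sum_mono) auto
  then have K1: "(\<Sum>x\<in>K. weight x) \<le> int (card K) * weight v" by simp
  have "(\<Sum>x\<in>R. weight x) \<le> (\<Sum>x\<in>R. weight v)" using max RV by (intro sum_mono) auto
  then have R1: "(\<Sum>x\<in>R. weight x) \<le> int (card R) * weight v" by simp
  have deg': "int (\<Sum>x\<in>V. card (inner x)) \<le> 2 * int (\<Sum>x\<in>K. card (inner x)) + int (\<Sum>x\<in>R. card (inner x))"
    using deg unfolding sum_distrib_left[symmetric] by linarith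
  have mis': "int (\<Sum>x\<in>K. card (missed x)) + int (\<Sum>x\<in>R. card (missed x)) \<le> int (\<Sum>x\<in>V. card (missed x))"
    using mis by linarith
  have "2 * surplus \<le> 2 * (\<Sum>x\<in>K. weight x) + (\<Sum>x\<in>R. weight x)"
  proof -
    have "2 * (a - f) \<le> 2 * (2 * b - d) + (2 * c - e)"
      if "a \<le> 2 * b + c" "d + e \<le> f" "0 \<le> e" for a b c d e f :: int
      using that by presburger
    from this[OF deg' mis' of_nat_0_le_iff] show ?thesis unfolding s wK wR .
  qed
  also have "\<dots> \<le> (2 * int (card K) + int (card R)) * weight v"
    using K1 R1 by (simp add: algebra_simps)
  also have "\<dots> \<le> (2 * int (card (inner v)) + 4 * int (card M) + int (card (missed v))) * weight v"
    using pos cK cR by (intro mult_right_mono) linarith+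
  finally show ?thesis using that[OF M(1,2) _ M(3)] by simp
qed

lemma surplus_le: "surplus \<le> 2 * (int D)\<^sup>2"
proof (cases "\<forall>x\<in>V. weight x \<le> 0")
  case True
  have "0 \<le> 2 * (int D)\<^sup>2" by simp
  then show ?thesis using surplus_negative_weights True by (meson order_trans)
next
  case False
  then obtain v where v: "v \<in> V" "\<forall>x\<in>V. weight x \<le> weight v" "0 \<le> weight v"
    using max_weight_exists by fastforce
  obtain M where "usable_matching v M" "card (inner v) + card M \<le> D"
    "2 * surplus \<le> (2 * int (card (inner v)) + 4 * int (card M) + int (card (missed v))) * weight v"
    "edges_dominated v (inner v \<union> \<Union>M)"
    by (rule surplus_estimate[OF v])
  then show ?thesis unfolding weight_def by (intro surplus_estimate_eval(1)) auto
qed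

text \<open>Equality in \<open>surplus_le\<close> leaves no room for a matching or for missed vertices at \<open>v\<close>, so all inner edges
  meet the \<open>D\<close> inner neighbours of \<open>v\<close>. As no inner degree exceeds \<open>D\<close>, these neighbours must all have
  inner degree \<open>D\<close> and be independent.\<close>

lemma surplus_extremal_vertex:
  assumes S: "surplus = 2 * (int D)\<^sup>2"
    and v: "v \<in> V" and max: "\<forall>x\<in>V. weight x \<le> weight v" and pos: "0 \<le> weight v"
  shows "card (inner v) = D" "\<And>x. x \<in> V \<Longrightarrow> missed x = {}"
    "\<And>y. y \<in> inner v \<Longrightarrow> card (inner y) = D \<and> inner y \<inter> inner v = {}"
    "\<And>x. x \<notin> inner v \<Longrightarrow> inner x \<subseteq> inner v"
proof -
  obtain M where M: "usable_matching v M" "card (inner v) + card M \<le> D"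
    "2 * surplus \<le> (2 * int (card (inner v)) + 4 * int (card M) + int (card (missed v))) * weight v"
    "edges_dominated v (inner v \<union> \<Union>M)"
    by (rule surplus_estimate[OF v max pos])
  have *: "int (card M) = 0 \<and> int (card (missed v)) = 0 \<and> int (card (inner v)) = int D"
    using M(2,3) S unfolding weight_def by (intro surplus_estimate_eval(2)) auto
  then have M0: "M = {}" and m0: "missed v = {}" using usable_matching_finite[OF M(1)] by auto
  show cv: "card (inner v) = D" using * by simp
  show out: "inner x \<subseteq> inner v" if "x \<notin> inner v" for x
  proof
    fix y assume y: "y \<in> inner x"
    have "x \<in> missed v" if "y \<notin> inner v"
      using M(4) \<open>x \<notin> inner v\<close> y that
      unfolding M0 edges_dominated_def inner_def[of x] Union_empty Un_empty_right mem_Collect_eq by blast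
    then show "y \<in> inner v" using m0 by blast
  qed
  have um: "usable_matching x {}" for x by (simp add: usable_matching_def)
  have le: "card (inner x) \<le> D" if "x \<in> V" for x
    using bounded_star[OF that um] by simp
  have "(\<Sum>x\<in>V - inner v. card (inner x - inner v)) = 0"
    using out by (simp add: Diff_eq_empty_iff[THEN iffD2])
  then have sum: "(\<Sum>x\<in>V. card (inner x)) = (\<Sum>x\<in>inner v. card (inner x) + card (inner x - inner v))"
    using inner_degree_split[OF inner_subset, of v] by simp
  have deg_le: "card (inner x) + card (inner x - inner v) \<le> 2 * D" if "x \<in> inner v" for x
    using le[of x] card_mono[of "inner x" "inner x - inner v"] that inner_subset by fastforce
  have "(\<Sum>x\<in>inner v. card (inner x) + card (inner x - inner v)) \<le> card (inner v) * (2 * D)"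
    using sum_bounded_above[of "inner v" _ "2 * D"] deg_le by simp
  then have up: "(\<Sum>x\<in>V. card (inner x)) \<le> 2 * D\<^sup>2" using sum cv by (simp add: power2_eq_square)
  have "surplus = int (\<Sum>x\<in>V. card (inner x)) - int (\<Sum>x\<in>V. card (missed x))"
    by (simp add: surplus_def sum_subtractf)
  then have eq: "int (\<Sum>x\<in>V. card (inner x)) = int (2 * D\<^sup>2) + int (\<Sum>x\<in>V. card (missed x))"
    using S by simp
  then have "(\<Sum>x\<in>V. card (missed x)) = 0" using up by linarith
  then show "missed x = {}" if "x \<in> V" for x using finite_V that by simp
  have "2 * D\<^sup>2 \<le> (\<Sum>x\<in>V. card (inner x))" using eq by linarith
  then have low: "card (inner v) * (2 * D) \<le> (\<Sum>x\<in>inner v. card (inner x) + card (inner x - inner v))"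
    using sum cv by (simp add: power2_eq_square)
  fix y assume y: "y \<in> inner v"
  have t: "card (inner y) + card (inner y - inner v) = 2 * D"
    using sum_eq_bound_imp_eq[OF finite_inner deg_le low y] .
  have "card (inner y - inner v) \<le> card (inner y)" by (intro card_mono) auto
  moreover have "card (inner y) \<le> D" using le y inner_subset by blast
  ultimately have "card (inner y) = D" "card (inner y - inner v) = card (inner y)" using t by auto
  moreover then have "inner y - inner v = inner y" by (intro card_subset_eq) auto
  ultimately show "card (inner y) = D \<and> inner y \<inter> inner v = {}" by blast
qed

text \<open>An inner neighbour \<open>u\<close> of \<open>v\<close> again has maximal weight, so both inner neighbourhoods are
  independent, of size \<open>D\<close>, and meet all inner edges. They are the classes of the \<open>K\<^bsub>D,D\<^esub>\<close>, and
  they lie on one side because inner edges do.\<close>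

lemma surplus_extremal:
  assumes S: "surplus = 2 * (int D)\<^sup>2" and D: "1 \<le> D"
  shows "\<exists>A B. A \<inter> B = {} \<and> card A = D \<and> card B = D \<and> (A \<union> B \<subseteq> P \<or> A \<union> B \<subseteq> Q) \<and>
     (\<forall>x\<in>V. \<forall>y\<in>V. adj x y \<longleftrightarrow> \<not> same x y \<or> x \<in> A \<and> y \<in> B \<or> x \<in> B \<and> y \<in> A)"
proof -
  have "\<not> (\<forall>x\<in>V. weight x \<le> 0)"
  proof
    assume "\<forall>x\<in>V. weight x \<le> 0"
    then have "surplus \<le> 0" using surplus_negative_weights by auto
    moreover have "0 < (int D)\<^sup>2" using D by simp
    ultimately show False using S by linarith
  qed
  then obtain v where v: "v \<in> V" "\<forall>x\<in>V. weight x \<le> weight v" "0 \<le> weight v"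
    using max_weight_exists by fastforce
  note ev = surplus_extremal_vertex[OF S v]
  obtain u where u: "u \<in> inner v" using ev(1) D by fastforce
  have uV: "u \<in> V" using u inner_subset by blast
  have "weight u = weight v" using ev(1) ev(3)[OF u] ev(2) uV v(1) by (simp add: weight_def)
  then have eu: "\<And>y. y \<in> inner u \<Longrightarrow> card (inner y) = D \<and> inner y \<inter> inner u = {}"
    "\<And>x. x \<notin> inner u \<Longrightarrow> inner x \<subseteq> inner u" "card (inner u) = D"
    using surplus_extremal_vertex[OF S uV] v by auto
  define A where "A = inner u"
  define B where "B = inner v"
  have AB: "A \<inter> B = {}" using ev(3)[OF u] by (auto simp: A_def B_def)
  have innB: "inner x = A" if "x \<in> B" for x
  proof (rule card_subset_eq)
    have "x \<notin> A" using that AB by auto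
    then show "inner x \<subseteq> A" using eu(2) by (simp add: A_def)
    show "card (inner x) = card A" using ev(3) eu(3) that by (simp add: A_def B_def)
  qed (simp add: A_def)
  have adjAB: "y \<in> inner x \<longleftrightarrow> x \<in> A \<and> y \<in> B \<or> x \<in> B \<and> y \<in> A" for x y
  proof (cases "x \<in> B")
    case True
    then show ?thesis using innB AB by auto
  next
    case False
    then have "inner x \<subseteq> B" using ev(4) by (simp add: B_def)
    then show ?thesis using False innB inner_sym by blast
  qed
  have side: "\<And>x. x \<in> A \<union> B \<Longrightarrow> same v x \<and> x \<in> V"
    using u inner_subset by (auto simp: A_def B_def inner_def same_def)
  then have "A \<union> B \<subseteq> P \<or> A \<union> B \<subseteq> Q" using V_eq PQ v(1) unfolding same_def by blast
  moreover have "adj x y \<longleftrightarrow> \<not> same x y \<or> x \<in> A \<and> y \<in> B \<or> x \<in> B \<and> y \<in> A"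
    if xy: "x \<in> V" "y \<in> V" for x y
  proof (cases "same x y")
    case True
    then show ?thesis using adjAB[of y x] by (auto simp: inner_def)
  next
    case False
    then show ?thesis using ev(2)[OF xy(1)] xy by (auto simp: missed_def)
  qed
  ultimately show ?thesis using AB ev(1) eu(3) unfolding A_def B_def by blast
qed

end

end

text \<open>A vertex is adjacent to its inner neighbours and to all of the other side but the missed vertices.\<close>

lemma (in cut_graph) degree_sum_surplus:
  "int (\<Sum>v\<in>V. card (nbrs v)) = 2 * int (card P * card Q) + surplus"
proof -
  have fin: "finite P" "finite Q" using finite_V V_eq by auto
  have deg: "card (nbrs v) + card (missed v) = card (inner v) + card (if v \<in> P then Q else P)"
    if v: "v \<in> V" for v
  proof -
    define R where "R = (if v \<in> P then Q else P)"
    have R: "x \<in> R \<longleftrightarrow> x \<in> V \<and> \<not> same v x" for x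
      using PQ v by (auto simp: R_def V_eq same_def)
    have "card (nbrs v) = card (inner v \<union> (nbrs v \<inter> R))"
      using R nbrs_subset[of v] by (intro arg_cong[of _ _ card]) (auto simp: inner_def nbrs_def)
    also have "\<dots> = card (inner v) + card (nbrs v \<inter> R)"
    proof (rule card_Un_disjoint)
      show "inner v \<inter> (nbrs v \<inter> R) = {}" using R by (auto simp: inner_def)
    qed simp_all
    finally have 1: "card (nbrs v) = card (inner v) + card (nbrs v \<inter> R)" .
    have "card R = card ((nbrs v \<inter> R) \<union> missed v)"
      using R by (intro arg_cong[of _ _ card]) (auto simp: missed_def nbrs_def)
    also have "\<dots> = card (nbrs v \<inter> R) + card (missed v)"
    proof (rule card_Un_disjoint)
      show "nbrs v \<inter> R \<inter> missed v = {}" by (auto simp: missed_def nbrs_def)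
    qed simp_all
    finally show ?thesis using 1 unfolding R_def[symmetric] by simp
  qed
  have PV: "P \<subseteq> V" and VP: "V - P = Q" using V_eq PQ by auto
  have "(\<Sum>v\<in>V. card (if v \<in> P then Q else P)) = (\<Sum>v\<in>P. card Q) + (\<Sum>v\<in>Q. card P)"
  proof -
    have "(\<Sum>v\<in>P. card (if v \<in> P then Q else P)) = (\<Sum>v\<in>P. card Q)" by (intro sum.cong) auto
    moreover have "(\<Sum>v\<in>Q. card (if v \<in> P then Q else P)) = (\<Sum>v\<in>Q. card P)"
      using PQ by (intro sum.cong) auto
    ultimately show ?thesis
      using sum.subset_diff[OF PV finite_V, of "\<lambda>v. card (if v \<in> P then Q else P)"] unfolding VP by linarith
  qed
  then have cross: "(\<Sum>v\<in>V. card (if v \<in> P then Q else P)) = 2 * (card P * card Q)" by simp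
  have "(\<Sum>v\<in>V. card (nbrs v) + card (missed v)) = (\<Sum>v\<in>V. card (inner v) + card (if v \<in> P then Q else P))"
    using deg by (rule sum.cong[OF refl])
  then have "(\<Sum>v\<in>V. card (nbrs v)) + (\<Sum>v\<in>V. card (missed v)) = (\<Sum>v\<in>V. card (inner v)) + 2 * (card P * card Q)"
    unfolding sum.distrib cross .
  moreover have "surplus = int (\<Sum>v\<in>V. card (inner v)) - int (\<Sum>v\<in>V. card (missed v))"
    by (simp add: surplus_def sum_subtractf)
  ultimately show ?thesis by linarith
qed

section \<open>Partition of a graph with large minimum degree\<close>

context ugraph
begin

lemma sum_card_nbrs:
  assumes "W \<subseteq> V"
  shows "(\<Sum>v\<in>V. card (nbrs v \<inter> W)) = (\<Sum>x\<in>W. card (nbrs x))"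
proof -
  have "finite W" using assms finite_V finite_subset by blast
  have "nbrs v \<inter> W = {x\<in>W. adj v x}" for v by (auto simp: nbrs_def)
  moreover have "nbrs x = {v\<in>V. adj v x}" for x
  proof -
    have "adj x y \<longleftrightarrow> y \<in> V \<and> adj y x" for y using adj_sym adj_V by metis
    then show ?thesis by (simp add: nbrs_def)
  qed
  ultimately show ?thesis using sum_card_swap[OF finite_V \<open>finite W\<close>] by simp
qed

text \<open>Fix a set \<open>W\<close> of \<open>4 * t\<close> vertices. By the degree condition about a quarter of all vertices have at
  least \<open>t\<close> neighbours in \<open>W\<close>, and among these many have the same trace on \<open>W\<close>, as there are at
  most \<open>2 ^ (4 * t)\<close> traces.\<close>

lemma complete_bipartite_pair:
  assumes deg: "\<And>v. v \<in> V \<Longrightarrow> card V div 2 \<le> card (nbrs v)"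
    and t: "0 < t" and big: "4 * t * 2 ^ (4 * t) + 4 \<le> card V"
  obtains A B where "A \<subseteq> V" "B \<subseteq> V" "card A = t" "card B = t" "\<forall>a\<in>A. \<forall>b\<in>B. adj a b"
proof -
  have "4 * t * 1 \<le> 4 * t * 2 ^ (4 * t)" by (intro mult_le_mono2) simp
  then have "4 * t \<le> card V" using big by linarith
  then obtain W where W: "W \<subseteq> V" "card W = 4 * t" "finite W" by (rule obtain_subset_with_card_n)
  define U where "U = {v\<in>V. t \<le> card (nbrs v \<inter> W)}"
  have UV: "U \<subseteq> V" "finite U" using finite_V by (auto simp: U_def)
  have "4 * t * (card V div 2) = (\<Sum>x\<in>W. card V div 2)" using W by simp
  also have "\<dots> \<le> (\<Sum>x\<in>W. card (nbrs x))" using deg W by (intro sum_mono) auto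
  also have "\<dots> = (\<Sum>v\<in>V. card (nbrs v \<inter> W))" using sum_card_nbrs[OF W(1)] by simp
  also have "\<dots> = (\<Sum>v\<in>U. card (nbrs v \<inter> W)) + (\<Sum>v\<in>V-U. card (nbrs v \<inter> W))"
    using sum.subset_diff[OF UV(1) finite_V, of "\<lambda>v. card (nbrs v \<inter> W)"] by simp
  also have "\<dots> \<le> (\<Sum>v\<in>U. 4 * t) + (\<Sum>v\<in>V-U. t)"
  proof (intro add_mono sum_mono)
    fix v show "card (nbrs v \<inter> W) \<le> 4 * t" using W card_mono[of W "nbrs v \<inter> W"] by simp
  next
    fix v assume "v \<in> V - U"
    then show "card (nbrs v \<inter> W) \<le> t" unfolding U_def by (simp add: not_le less_imp_le)
  qed
  also have "\<dots> \<le> card U * (4 * t) + card V * t"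
    using card_mono[OF finite_V, of "V - U"] by simp
  finally have "t * (4 * (card V div 2)) \<le> t * (4 * card U + card V)" by (simp add: algebra_simps)
  then have "4 * (card V div 2) \<le> 4 * card U + card V" using t by simp
  then have cU: "card V \<le> 4 * card U + 2" by presburger
  define fib where "fib S = {v\<in>U. nbrs v \<inter> W = S}" for S
  have "\<exists>S\<in>Pow W. t \<le> card (fib S)"
  proof (rule ccontr)
    assume none: "\<not> (\<exists>S\<in>Pow W. t \<le> card (fib S))"
    have small: "card (fib S) \<le> t" if "S \<in> Pow W" for S
    proof -
      have "\<not> t \<le> card (fib S)" using none that by blast
      then show ?thesis by simp
    qed
    have "U \<subseteq> (\<Union>S\<in>Pow W. fib S)"
    proof
      fix x assume "x \<in> U"
      then have "x \<in> fib (nbrs x \<inter> W)" by (simp add: fib_def)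
      then show "x \<in> (\<Union>S\<in>Pow W. fib S)" by blast
    qed
    then have "card U \<le> card (\<Union>S\<in>Pow W. fib S)"
      using W UV by (intro card_mono) (auto simp: fib_def)
    also have "\<dots> \<le> (\<Sum>S\<in>Pow W. card (fib S))" using W by (intro card_UN_le) simp
    also have "\<dots> \<le> (\<Sum>S\<in>Pow W. t)" using small by (rule sum_mono)
    also have "\<dots> = 2 ^ (4 * t) * t" using W by (simp add: card_Pow)
    finally have "4 * card U \<le> 4 * t * 2 ^ (4 * t)" by (simp add: mult_ac)
    then show False using cU big by linarith
  qed
  then obtain S where S: "S \<subseteq> W" "t \<le> card (fib S)" by auto
  then obtain B where B: "B \<subseteq> fib S" "card B = t" "finite B" by (meson obtain_subset_with_card_n)
  then obtain b where "b \<in> fib S" using t by fastforce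
  then have "t \<le> card S" by (auto simp: fib_def U_def)
  then obtain A where A: "A \<subseteq> S" "card A = t" "finite A" by (meson obtain_subset_with_card_n)
  show ?thesis
  proof (rule that[OF _ _ A(2) B(2)])
    show "A \<subseteq> V" using A S W by auto
    show "B \<subseteq> V" using B UV by (auto simp: fib_def)
    have "adj a b" if "a \<in> A" "b \<in> B" for a b
    proof -
      have "a \<in> nbrs b" using A B that by (auto simp: fib_def)
      then show ?thesis using adj_sym by (simp add: nbrs_def)
    qed
    then show "\<forall>a\<in>A. \<forall>b\<in>B. adj a b" by blast
  qed
qed

context
  fixes k q L :: nat
  assumes k: "1 \<le> k" and q: "5 \<le> q" "odd q" and L: "k * q + q + 4 \<le> L"
    and no_flower: "\<not> flower k q"
begin

text \<open>Otherwise \<open>v\<close> would be the centre of a flower built without any seeds.\<close>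

lemma not_two_sided:
  assumes lk: "linked P Q L" and PQ: "L \<le> card (nbrs v \<inter> P)"
  shows "card (nbrs v \<inter> Q) < L"
proof (rule ccontr)
  assume "\<not> card (nbrs v \<inter> Q) < L"
  have "flower k q"
  proof (rule flower_from_seeds[of k "\<lambda>_. {}" q v])
    fix i and F :: "'a set" assume "i < k" "finite F" "card F \<le> k * q"
    then show "\<exists>p. petal q v p \<and> set p \<inter> F = {}"
      using petal_two_sided[OF lk q PQ] \<open>\<not> card (nbrs v \<inter> Q) < L\<close> L by simp
  qed (use q in auto)
  with no_flower show False ..
qed

text \<open>A matching of \<open>k\<close> edges inside \<open>Q\<close> gives a flower centred at any vertex of \<open>Q\<close> that it leaves
  uncovered. So a maximum matching is small, and the vertices it covers form \<open>S\<close>.\<close>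

lemma vertex_cover_in_side:
  assumes lk: "linked P Q L" and Q: "Q \<subseteq> V" "2 * k < card Q"
  shows "\<exists>S\<subseteq>Q. card S \<le> 2 * k \<and> (\<forall>x\<in>Q - S. \<forall>y\<in>Q - S. \<not> adj x y)"
proof -
  define mat where
    "mat M \<longleftrightarrow> pairwise disjnt M \<and> (\<forall>e\<in>M. \<exists>x\<in>Q. \<exists>y\<in>Q. e = {x, y} \<and> adj x y)" for M
  have finQ: "finite Q" using Q finite_V finite_subset by blast
  have sub: "\<Union>M \<subseteq> Q" "finite M" "card (\<Union>M) \<le> 2 * card M" if M: "mat M" for M
  proof -
    show s: "\<Union>M \<subseteq> Q" using M unfolding mat_def by fastforce
    then have "M \<subseteq> Pow Q" by auto
    then show f: "finite M" using finQ finite_subset by blast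
    have "card (\<Union>M) \<le> (\<Sum>e\<in>M. card e)" by (rule card_Union_le_sum_card)
    also have "\<dots> \<le> (\<Sum>e\<in>M. 2)"
    proof (rule sum_mono)
      fix e assume "e \<in> M"
      then obtain x y where "e = {x, y}" using M unfolding mat_def by blast
      then show "card e \<le> 2" by (simp add: card_insert_if)
    qed
    finally show "card (\<Union>M) \<le> 2 * card M" by simp
  qed
  have no_k: "card M < k" if M: "mat M" for M
  proof (rule ccontr)
    assume "\<not> card M < k"
    then obtain N where N: "N \<subseteq> M" "card N = k" "finite N"
      by (meson not_less obtain_subset_with_card_n)
    have mN: "mat N" using M N(1) unfolding mat_def by (meson pairwise_subset subsetD)
    have "card (\<Union>N) < card Q" using sub(3)[OF mN] N Q by simp
    moreover have "finite (\<Union>N)" using sub(1)[OF mN] finQ finite_subset by blast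
    ultimately obtain v where v: "v \<in> Q" "v \<notin> \<Union>N" using ex_outside by blast
    have "flower k q"
    proof (rule star_matching_flower[OF linked_sym[OF lk] L q v(1), of "{}" N])
      fix e assume e: "e \<in> N"
      then obtain x y where "x \<in> Q" "y \<in> Q" "e = {x, y}" "adj x y" using mN unfolding mat_def by blast
      moreover have "v \<notin> e" using v e by blast
      ultimately show "\<exists>x y. e = {x, y} \<and> adj x y \<and> v \<notin> e \<and> e \<inter> {} = {} \<and>
          (x \<in> Q \<and> y \<in> Q \<or> x \<in> P \<and> y \<in> P \<and> adj v x)" by blast
    qed (use N mN in \<open>auto simp: mat_def\<close>)
    with no_flower show False ..
  qed
  have "mat {}" by (simp add: mat_def)
  moreover have "\<forall>M. mat M \<longrightarrow> card M < k" using no_k by blast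
  ultimately obtain M where M: "mat M" "\<And>M'. mat M' \<Longrightarrow> card M' \<le> card M"
    using ex_has_greatest_nat[of mat "{}" card] by blast
  have "\<not> adj x y" if xy: "x \<in> Q - \<Union>M" "y \<in> Q - \<Union>M" for x y
  proof
    assume a: "adj x y"
    have "mat (insert {x, y} M)"
      unfolding mat_def
    proof (intro conjI ballI)
      show "pairwise disjnt (insert {x, y} M)"
        using M(1) xy unfolding mat_def pairwise_insert disjnt_def by auto
      fix e assume "e \<in> insert {x, y} M"
      then show "\<exists>x\<in>Q. \<exists>y\<in>Q. e = {x, y} \<and> adj x y"
      proof
        assume "e = {x, y}"
        then show ?thesis using xy a by blast
      qed (use M(1) in \<open>simp add: mat_def\<close>)
    qed
    from M(2)[OF this] have "card (insert {x, y} M) \<le> card M" .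
    moreover have "{x, y} \<notin> M" using xy by auto
    ultimately show False using sub(2)[OF M(1)] by simp
  qed
  moreover have "card (\<Union>M) \<le> 2 * k" using sub(3)[OF M(1)] no_k[OF M(1)] by linarith
  ultimately show ?thesis using sub(1)[OF M(1)] by blast
qed

text \<open>Every vertex has fewer than \<open>33 * L\<close> neighbours in \<open>A \<union> B\<close>, an exceptional one fewer than
  \<open>25 * L\<close>, while the average is about \<open>32 * L\<close>.\<close>

lemma few_exceptional_vertices:
  assumes deg: "\<And>v. v \<in> V \<Longrightarrow> card V div 2 \<le> card (nbrs v)"
    and A: "A \<subseteq> V" "card A = 32 * L" and B: "B \<subseteq> V" "card B = 32 * L" and lk: "linked A B L"
  shows "8 * card {v\<in>V. card (nbrs v \<inter> A) < 24 * L \<and> card (nbrs v \<inter> B) < 24 * L} \<le> card V + 32"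
proof -
  define Z where "Z = {v\<in>V. card (nbrs v \<inter> A) < 24 * L \<and> card (nbrs v \<inter> B) < 24 * L}"
  have ZV: "Z \<subseteq> V" "finite Z" using finite_V by (auto simp: Z_def)
  have fin: "finite A" "finite B" using A B finite_V finite_subset by blast+
  have AB: "A \<inter> B = {}" using lk by (simp add: linked_def)
  have split: "card (nbrs v \<inter> (A \<union> B)) = card (nbrs v \<inter> A) + card (nbrs v \<inter> B)" for v
    unfolding Int_Un_distrib using AB by (intro card_Un_disjoint) auto
  have leA: "card (nbrs v \<inter> A) \<le> 32 * L" "card (nbrs v \<inter> B) \<le> 32 * L" for v
    using fin A B card_mono[of A "nbrs v \<inter> A"] card_mono[of B "nbrs v \<inter> B"] by auto
  have one: "card (nbrs v \<inter> A) < L \<or> card (nbrs v \<inter> B) < L" for v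
    using not_two_sided[OF lk, of v] by linarith
  have "64 * L * (card V div 2) = (\<Sum>x\<in>A \<union> B. card V div 2)"
    using fin AB A B by (simp add: card_Un_disjoint)
  also have "\<dots> \<le> (\<Sum>x\<in>A \<union> B. card (nbrs x))" using deg A B by (intro sum_mono) auto
  also have "\<dots> = (\<Sum>v\<in>V. card (nbrs v \<inter> (A \<union> B)))" using sum_card_nbrs[of "A \<union> B"] A B by simp
  also have "\<dots> = (\<Sum>v\<in>Z. card (nbrs v \<inter> (A \<union> B))) + (\<Sum>v\<in>V-Z. card (nbrs v \<inter> (A \<union> B)))"
    using sum.subset_diff[OF ZV(1) finite_V, of "\<lambda>v. card (nbrs v \<inter> (A \<union> B))"] by simp
  also have "\<dots> \<le> (\<Sum>v\<in>Z. 25 * L) + (\<Sum>v\<in>V-Z. 33 * L)"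
  proof (intro add_mono sum_mono)
    fix v assume "v \<in> Z"
    then show "card (nbrs v \<inter> (A \<union> B)) \<le> 25 * L" using one[of v] unfolding split Z_def by auto
  next
    fix v
    show "card (nbrs v \<inter> (A \<union> B)) \<le> 33 * L" using one[of v] leA[of v] unfolding split by linarith
  qed
  also have "\<dots> = L * (25 * card Z + 33 * card (V - Z))" by (simp add: algebra_simps)
  finally have "L * (64 * (card V div 2)) \<le> L * (25 * card Z + 33 * card (V - Z))"
    by (simp add: algebra_simps)
  then have "64 * (card V div 2) \<le> 25 * card Z + 33 * card (V - Z)" using L by simp
  moreover have "card V = card Z + card (V - Z)"
    using card_Diff_subset[OF ZV(2,1)] card_mono[OF finite_V ZV(1)] by simp
  moreover have "card V \<le> 2 * (card V div 2) + 1" by presburger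
  ultimately show ?thesis unfolding Z_def[symmetric] by linarith
qed

text \<open>The exponential bound is the one of the pigeonhole argument, with classes of \<open>32 * L\<close> vertices; it
  dominates the other requirements on the order, which are linear in \<open>L\<close>.\<close>

lemma linked_partition:
  assumes deg: "\<And>v. v \<in> V \<Longrightarrow> card V div 2 \<le> card (nbrs v)"
    and big: "128 * L * 2 ^ (128 * L) + 4 \<le> card V"
  obtains P Q where "V = P \<union> Q" "P \<inter> Q = {}" "linked P Q L"
proof -
  have L0: "0 < L" using L by simp
  have kL: "5 * k + 9 \<le> L" using L q mult_le_mono2[OF q(1), of k] by linarith
  have tt: "4 * (32 * L) = 128 * L" by simp
  have big': "4 * (32 * L) * 2 ^ (4 * (32 * L)) + 4 \<le> card V" unfolding tt by (rule big)
  obtain A B where A: "A \<subseteq> V" "card A = 32 * L" and B: "B \<subseteq> V" "card B = 32 * L"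
    and AB': "\<forall>a\<in>A. \<forall>b\<in>B. adj a b"
    using complete_bipartite_pair[OF deg _ big'] L0 by (metis mult_pos_pos zero_less_numeral)
  have AB: "adj a b" if "a \<in> A" "b \<in> B" for a b using AB' that by blast
  have BA: "adj b a" if "a \<in> A" "b \<in> B" for a b using AB[OF that] adj_sym by blast
  have fin: "finite A" "finite B" using A B finite_V finite_subset by blast+
  have disj: "A \<inter> B = {}" using AB adj_irrefl by blast
  have nA: "nbrs a \<inter> B = B" if "a \<in> A" for a using AB that by (auto simp: nbrs_def)
  have nB: "nbrs b \<inter> A = A" if "b \<in> B" for b using BA that by (auto simp: nbrs_def)
  have nA2: "nbrs a \<inter> nbrs a' \<inter> B = B" if "a \<in> A" "a' \<in> A" for a a' using nA[of a] nA[of a'] that by blast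
  have nB2: "nbrs a \<inter> nbrs a' \<inter> A = A" if "a \<in> B" "a' \<in> B" for a a' using nB[of a] nB[of a'] that by blast
  have lk: "linked A B L" unfolding linked_def using disj nA2 nB2 A B by simp
  define X where "X = {v\<in>V. 24 * L \<le> card (nbrs v \<inter> A)}"
  define Y where "Y = {v\<in>V. 24 * L \<le> card (nbrs v \<inter> B)}"
  have BX: "B \<subseteq> X" using B nB A by (auto simp: X_def)
  have AY: "A \<subseteq> Y" using A nA B by (auto simp: Y_def)
  have XY: "X \<inter> Y = {}"
  proof -
    have "v \<notin> Y" if "v \<in> X" for v
      using not_two_sided[OF lk, of v] that L0 by (auto simp: X_def Y_def)
    then show ?thesis by blast
  qed
  have XV: "X \<subseteq> V" "Y \<subseteq> V" "finite X" "finite Y" using finite_V by (auto simp: X_def Y_def)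
  have lkX: "linked A X L" unfolding linked_def
  proof (intro conjI ballI)
    show "A \<inter> X = {}" using AY XY by auto
    fix x y assume "x \<in> A" "y \<in> A"
    then have "B \<subseteq> nbrs x \<inter> nbrs y \<inter> X" using nA2 BX by blast
    then have "card B \<le> card (nbrs x \<inter> nbrs y \<inter> X)" using XV by (intro card_mono) auto
    then show "L \<le> card (nbrs x \<inter> nbrs y \<inter> X)" using B by linarith
  next
    fix x y assume "x \<in> X" "y \<in> X"
    then show "L \<le> card (nbrs x \<inter> nbrs y \<inter> A)"
      using A by (intro card_common_lower[OF fin(1), of "24 * L"]) (auto simp: X_def)
  qed
  have lkY: "linked B Y L" unfolding linked_def
  proof (intro conjI ballI)
    show "B \<inter> Y = {}" using BX XY by auto
    fix x y assume "x \<in> B" "y \<in> B"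
    then have "A \<subseteq> nbrs x \<inter> nbrs y \<inter> Y" using nB2 AY by blast
    then have "card A \<le> card (nbrs x \<inter> nbrs y \<inter> Y)" using XV by (intro card_mono) auto
    then show "L \<le> card (nbrs x \<inter> nbrs y \<inter> Y)" using A by linarith
  next
    fix x y assume "x \<in> Y" "y \<in> Y"
    then show "L \<le> card (nbrs x \<inter> nbrs y \<inter> B)"
      using B by (intro card_common_lower[OF fin(2), of "24 * L"]) (auto simp: Y_def)
  qed
  have cX: "32 * L \<le> card X" "32 * L \<le> card Y"
    using card_mono[OF XV(3) BX] card_mono[OF XV(4) AY] A B by auto
  obtain S where S: "S \<subseteq> X" "card S \<le> 2 * k" "\<forall>x\<in>X - S. \<forall>y\<in>X - S. \<not> adj x y"
    using vertex_cover_in_side[OF lkX XV(1)] cX kL by auto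
  obtain S' where S': "S' \<subseteq> Y" "card S' \<le> 2 * k" "\<forall>x\<in>Y - S'. \<forall>y\<in>Y - S'. \<not> adj x y"
    using vertex_cover_in_side[OF lkY XV(2)] cX kL by auto
  define X' where "X' = X - S"
  define Y' where "Y' = Y - S'"
  define Z where "Z = V - (X' \<union> Y')"
  define h where "h = card V div 2"
  have finS: "finite S" "finite S'" using S S' XV finite_subset by blast+
  have fin': "finite X'" "finite Y'" "finite Z" using XV finite_V by (auto simp: X'_def Y'_def Z_def)
  have disj': "X' \<inter> Y' = {}" using XY by (auto simp: X'_def Y'_def)
  have V3: "V = X' \<union> Y' \<union> Z" using XV by (auto simp: Z_def X'_def Y'_def)
  have "card X' + card Y' = card (X' \<union> Y')" using disj' fin' by (simp add: card_Un_disjoint)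
  also have "\<dots> + card Z = card V"
  proof -
    have "X' \<union> Y' \<subseteq> V" using V3 by blast
    then show ?thesis
      using card_Diff_subset[of "X' \<union> Y'" V] card_mono[OF finite_V, of "X' \<union> Y'"] fin'
      by (simp add: Z_def)
  qed
  finally have cV: "card X' + card Y' + card Z = card V" by simp
  have "Z \<subseteq> {v\<in>V. card (nbrs v \<inter> A) < 24 * L \<and> card (nbrs v \<inter> B) < 24 * L} \<union> (S \<union> S')"
    by (auto simp: Z_def X'_def Y'_def X_def Y_def)
  then have "card Z \<le> card ({v\<in>V. card (nbrs v \<inter> A) < 24 * L \<and> card (nbrs v \<inter> B) < 24 * L} \<union> (S \<union> S'))"
    using finite_V finS by (intro card_mono) auto
  also have "\<dots> \<le> card {v\<in>V. card (nbrs v \<inter> A) < 24 * L \<and> card (nbrs v \<inter> B) < 24 * L} + (card S + card S')"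
    by (meson add_left_mono card_Un_le order_trans)
  finally have "8 * card Z \<le> card V + 32 + 32 * k"
    using few_exceptional_vertices[OF deg A B lk] S(2) S'(2) by linarith
  moreover have "12 * L + 38 + 32 * k \<le> card V"
  proof -
    have "128 * L * 1 \<le> 128 * L * 2 ^ (128 * L)" by (intro mult_le_mono2) simp
    then show ?thesis using big kL by linarith
  qed
  moreover have h2: "card V \<le> 2 * h + 1" unfolding h_def by presburger
  ultimately have key: "card V + 3 * L + 2 * card Z \<le> 3 * h" by linarith
  have "2 * h \<le> card V" by (simp add: h_def)
  then have hz: "3 * L + 2 * card Z \<le> h" using key by linarith
  have degX: "h \<le> card (nbrs v \<inter> X') + card (nbrs v \<inter> Y') + card Z" if "v \<in> V" for v
  proof -
    have "h \<le> card (nbrs v)" using deg[OF that] by (simp add: h_def)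
    also have "\<dots> \<le> card (((nbrs v \<inter> X') \<union> (nbrs v \<inter> Y')) \<union> Z)"
      using nbrs_subset[of v] V3 fin' by (intro card_mono) auto
    also have "\<dots> \<le> card ((nbrs v \<inter> X') \<union> (nbrs v \<inter> Y')) + card Z" by (rule card_Un_le)
    also have "\<dots> \<le> card (nbrs v \<inter> X') + card (nbrs v \<inter> Y') + card Z" using card_Un_le by auto
    finally show ?thesis .
  qed
  have indX: "nbrs x \<inter> X' = {}" if "x \<in> X'" for x using S(3) that by (auto simp: X'_def nbrs_def)
  have indY: "nbrs x \<inter> Y' = {}" if "x \<in> Y'" for x using S'(3) that by (auto simp: Y'_def nbrs_def)
  have X'V: "X' \<subseteq> V" "Y' \<subseteq> V" using V3 by auto
  have dX: "h - card Z \<le> card (nbrs x \<inter> Y')" if "x \<in> X'" for x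
    using degX[of x] indX[OF that] that X'V by auto
  have dY: "h - card Z \<le> card (nbrs x \<inter> X')" if "x \<in> Y'" for x
    using degX[of x] indY[OF that] that X'V by auto
  have "X' \<noteq> {}"
  proof
    assume "X' = {}"
    then have "card X \<le> card S" using finS by (intro card_mono) (auto simp: X'_def)
    then show False using cX S(2) kL by linarith
  qed
  then obtain x0 where "x0 \<in> X'" by auto
  \<comment> \<open>A vertex of one independent set has almost all of its neighbours in the other set, which is
    therefore large; as both are large, neither exceeds half of the order by much.\<close>
  then have cY': "h - card Z \<le> card Y'" using dX[of x0] card_mono[OF fin'(2), of "nbrs x0 \<inter> Y'"] by simp
  have "Y' \<noteq> {}"
  proof
    assume "Y' = {}"
    then have "card Y \<le> card S'" using finS by (intro card_mono) (auto simp: Y'_def)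
    then show False using cX S'(2) kL by linarith
  qed
  then obtain y0 where "y0 \<in> Y'" by auto
  then have cX': "h - card Z \<le> card X'" using dY[of y0] card_mono[OF fin'(1), of "nbrs y0 \<inter> X'"] by simp
  have cXh: "card X' + h \<le> card V" "card Y' + h \<le> card V" using cX' cY' cV key by linarith+
  have lk': "linked X' Y' L" unfolding linked_def
  proof (intro conjI ballI)
    fix x y assume "x \<in> X'" "y \<in> X'"
    then show "L \<le> card (nbrs x \<inter> nbrs y \<inter> Y')"
      using dX cXh key by (intro card_common_lower[OF fin'(2), of "h - card Z"]) auto
  next
    fix x y assume "x \<in> Y'" "y \<in> Y'"
    then show "L \<le> card (nbrs x \<inter> nbrs y \<inter> X')"
      using dY cXh key by (intro card_common_lower[OF fin'(1), of "h - card Z"]) auto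
  qed (rule disj')
  \<comment> \<open>A vertex outside \<open>P\<close> has few neighbours in \<open>Y'\<close>, because no vertex has many neighbours on both sides.\<close>
  define P where "P = {v\<in>V. card (nbrs v \<inter> X') < L}"
  define Q where "Q = V - P"
  have X'P: "X' \<subseteq> P" using indX X'V L0 by (auto simp: P_def)
  have Y'Q: "Y' \<subseteq> Q"
  proof
    fix y assume y: "y \<in> Y'"
    then show "y \<in> Q" using dY[OF y] X'V hz by (auto simp: P_def Q_def)
  qed
  have finPQ: "finite P" "finite Q" using finite_V by (auto simp: P_def Q_def)
  have dP: "h - card Z - L \<le> card (nbrs v \<inter> Y')" if "v \<in> P" for v
  proof -
    have "card (nbrs v \<inter> X') < L" "v \<in> V" using that by (auto simp: P_def)
    then show ?thesis using degX[of v] by linarith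
  qed
  have dQ: "h - card Z - L \<le> card (nbrs v \<inter> X')" if v: "v \<in> Q" for v
  proof -
    have "L \<le> card (nbrs v \<inter> X')" "v \<in> V" using v by (auto simp: P_def Q_def)
    then show ?thesis using not_two_sided[OF lk', of v] degX[of v] by linarith
  qed
  have "linked P Q L" unfolding linked_def
  proof (intro conjI ballI)
    fix x y assume xy: "x \<in> P" "y \<in> P"
    then have "L \<le> card (nbrs x \<inter> nbrs y \<inter> Y')"
      using dP cXh key by (intro card_common_lower[OF fin'(2), of "h - card Z - L"]) auto
    also have "\<dots> \<le> card (nbrs x \<inter> nbrs y \<inter> Q)" using Y'Q finPQ by (intro card_mono) auto
    finally show "L \<le> card (nbrs x \<inter> nbrs y \<inter> Q)" .
  next
    fix x y assume xy: "x \<in> Q" "y \<in> Q"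
    then have "L \<le> card (nbrs x \<inter> nbrs y \<inter> X')"
      using dQ cXh key by (intro card_common_lower[OF fin'(1), of "h - card Z - L"]) auto
    also have "\<dots> \<le> card (nbrs x \<inter> nbrs y \<inter> P)" using X'P finPQ by (intro card_mono) auto
    finally show "L \<le> card (nbrs x \<inter> nbrs y \<inter> P)" .
  qed (auto simp: Q_def)
  then show ?thesis using that[of P Q] by (auto simp: Q_def P_def)
qed

end

end

section \<open>Set-based graphs: degrees and the cycle graph\<close>

definition adjacent :: "'a graph \<Rightarrow> 'a \<Rightarrow> 'a \<Rightarrow> bool" where
  "adjacent G x y \<longleftrightarrow> {x, y} \<in> edges G"

definition degree :: "'a graph \<Rightarrow> 'a \<Rightarrow> nat" where
  "degree G v = card {y. adjacent G v y}"

lemma simple_graph_ugraph: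
  assumes "simple_graph G"
  shows "ugraph (vertices G) (adjacent G)"
proof
  show "finite (vertices G)" using assms by (simp add: simple_graph_def)
next
  fix x y assume "adjacent G x y"
  then show "adjacent G y x" by (simp add: adjacent_def insert_commute)
next
  fix x show "\<not> adjacent G x x"
  proof
    assume "adjacent G x x"
    then have "card {x, x} = 2" using assms unfolding adjacent_def simple_graph_def by blast
    then show False by simp
  qed
next
  fix x y assume "adjacent G x y"
  then show "x \<in> vertices G" using assms unfolding adjacent_def simple_graph_def by blast
qed

lemma edge_pairE:
  assumes "simple_graph G" "e \<in> edges G"
  obtains x y where "e = {x, y}" "adjacent G x y" "x \<noteq> y"
proof -
  have "card e = 2" using assms by (simp add: simple_graph_def)
  then obtain x y where "e = {x, y}" "x \<noteq> y" by (meson card_2_iff)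
  then show ?thesis using that assms(2) by (simp add: adjacent_def)
qed

lemma finite_edges: "simple_graph G \<Longrightarrow> finite (edges G)"
  unfolding simple_graph_def by (meson PowI finite_Pow_iff finite_subset subsetI)

lemma card_incident_edges:
  assumes G: "simple_graph G"
  shows "card {e\<in>edges G. v \<in> e} = degree G v"
proof -
  have "bij_betw (\<lambda>y. {v, y}) {y. adjacent G v y} {e\<in>edges G. v \<in> e}"
  proof (rule bij_betwI')
    fix x y show "({v, x} = {v, y}) = (x = y)" by (auto simp: doubleton_eq_iff)
  next
    fix y assume "y \<in> {y. adjacent G v y}"
    then show "{v, y} \<in> {e\<in>edges G. v \<in> e}" by (simp add: adjacent_def)
  next
    fix e assume e: "e \<in> {e\<in>edges G. v \<in> e}"
    then obtain x y where xy: "e = {x, y}" "adjacent G x y" using edge_pairE[OF G] by blast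
    then have "v = x \<or> v = y" using e by auto
    then show "\<exists>y\<in>{y. adjacent G v y}. e = {v, y}"
    proof
      assume "v = x" then show ?thesis using xy by blast
    next
      assume "v = y"
      then have "adjacent G v x" "e = {v, x}" using xy by (auto simp: adjacent_def insert_commute)
      then show ?thesis by blast
    qed
  qed
  then show ?thesis by (simp add: bij_betw_same_card degree_def)
qed

lemma handshake:
  assumes G: "simple_graph G"
  shows "(\<Sum>v\<in>vertices G. degree G v) = 2 * num_edges G"
proof -
  have fin: "finite (vertices G)" using G by (simp add: simple_graph_def)
  have "(\<Sum>v\<in>vertices G. degree G v) = (\<Sum>v\<in>vertices G. card {e\<in>edges G. v \<in> e})"
    using card_incident_edges[OF G] by simp
  also have "\<dots> = (\<Sum>e\<in>edges G. card {v\<in>vertices G. v \<in> e})"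
    using sum_card_swap[OF fin finite_edges[OF G]] .
  also have "\<dots> = (\<Sum>e\<in>edges G. 2)"
  proof (rule sum.cong[OF refl])
    fix e assume "e \<in> edges G"
    then have "e \<subseteq> vertices G" "card e = 2" using G by (auto simp: simple_graph_def)
    moreover from this have "{v\<in>vertices G. v \<in> e} = e" by auto
    ultimately show "card {v\<in>vertices G. v \<in> e} = 2" by simp
  qed
  finally show ?thesis by (simp add: num_edges_def)
qed

text \<open>The closed walk \<open>c # p i @ [c]\<close> lists the images of the vertices of the \<open>i\<close>-th cycle, with the
  image of position \<open>q mod q = 0\<close> once more at its end.\<close>

lemma flower_contains_cycles:
  assumes G: "simple_graph G" and k: "1 \<le> k" and q: "2 \<le> q"
    and fl: "ugraph.flower (adjacent G) k q"
  shows "contains_subgraph G (cycles_graph k q)"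
proof -
  interpret ugraph "vertices G" "adjacent G" using simple_graph_ugraph[OF G] .
  obtain c p where p: "\<forall>i<k. petal q c (p i)"
    and dis: "\<forall>i<k. \<forall>j<k. i \<noteq> j \<longrightarrow> set (p i) \<inter> set (p j) = {}"
    using fl unfolding flower_def by blast
  define w where "w i = c # p i @ [c]" for i
  define f where "f v = (if snd v = 0 then c else p (fst v) ! (snd v - 1))" for v :: "nat \<times> nat"
  have len: "length (p i) = q - 1" "distinct (p i)" "c \<notin> set (p i)" "successively (adjacent G) (w i)"
    if "i < k" for i using p that unfolding petal_def w_def by auto
  have lw: "length (w i) = q + 1" if "i < k" for i using len(1)[OF that] q by (simp add: w_def)
  have adjw: "adjacent G (w i ! j) (w i ! Suc j)" if "i < k" "j < q" for i j
    using len(4)[OF that(1)] lw[OF that(1)] that(2) by (simp add: successively_conv_nth)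
  have fw: "f (cyc_vertex i j) = w i ! j" if "i < k" "j < q" for i j
    using len(1)[OF that(1)] that(2)
    by (cases j) (auto simp: f_def cyc_vertex_def w_def nth_append)
  have fw': "f (cyc_vertex i (Suc j mod q)) = w i ! Suc j" if ij: "i < k" "j < q" for i j
  proof (cases "Suc j < q")
    case True
    then show ?thesis using fw[OF ij(1) True] by simp
  next
    case False
    then have "Suc j = q" using ij by simp
    moreover have "w i ! q = c" using len(1)[OF ij(1)] q by (auto simp: w_def nth_append nth_Cons split: nat.split)
    moreover have "f (cyc_vertex i 0) = c" by (simp add: f_def cyc_vertex_def)
    ultimately show ?thesis by simp
  qed
  have mem: "f (i, j) \<in> set (p i) \<and> f (i, j) = p i ! (j - 1)" if "i < k" "j < q" "j \<noteq> 0" for i j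
    using len(1)[OF that(1)] that by (simp add: f_def)
  have vert: "vertices (cycles_graph k q) = insert (0, 0) {(i, j) | i j. i < k \<and> j < q \<and> j \<noteq> 0}"
    (is "_ = ?W")
  proof
    show "vertices (cycles_graph k q) \<subseteq> ?W" by (auto simp: cycles_graph_def cyc_vertex_def)
    have "(0, 0) = cyc_vertex 0 0" by (simp add: cyc_vertex_def)
    moreover have "(i, j) = cyc_vertex i j" if "j \<noteq> 0" for i j using that by (simp add: cyc_vertex_def)
    ultimately show "?W \<subseteq> vertices (cycles_graph k q)"
      using k q unfolding cycles_graph_def fst_conv by fastforce
  qed
  have "inj_on f (vertices (cycles_graph k q))"
    unfolding vert
  proof (rule inj_onI)
    have f0: "f (0, 0) = c" by (simp add: f_def)
    fix a b assume a: "a \<in> ?W" and b: "b \<in> ?W" and eq: "f a = f b"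
    consider "a = (0, 0)" "b = (0, 0)" | i j where "a = (0, 0)" "b = (i, j)" "i < k" "j < q" "j \<noteq> 0"
      | i j where "b = (0, 0)" "a = (i, j)" "i < k" "j < q" "j \<noteq> 0"
      | i j i' j' where "a = (i, j)" "i < k" "j < q" "j \<noteq> 0" "b = (i', j')" "i' < k" "j' < q" "j' \<noteq> 0"
      using a b by blast
    then show "a = b"
    proof cases
      case 2 then show ?thesis using mem[of i j] len(3)[of i] f0 eq by auto
    next
      case 3 then show ?thesis using mem[of i j] len(3)[of i] f0 eq by auto
    next
      case 4
      have "i = i'"
      proof (rule ccontr)
        assume "i \<noteq> i'"
        then have "set (p i) \<inter> set (p i') = {}" using dis 4 by blast
        then show False using mem[of i j] mem[of i' j'] 4 eq by auto
      qed
      moreover have "j - 1 = j' - 1"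
        using mem[of i j] mem[of i' j'] 4 eq len(1,2)[OF 4(2)] nth_eq_iff_index_eq[OF len(2)[OF 4(2)], of "j - 1" "j' - 1"]
        unfolding \<open>i = i'\<close> by auto
      ultimately show ?thesis using 4 by auto
    qed simp
  qed
  moreover have "f ` vertices (cycles_graph k q) \<subseteq> vertices G"
  proof
    fix y assume "y \<in> f ` vertices (cycles_graph k q)"
    then obtain i j where "i < k" "j < q" "y = f (cyc_vertex i j)" by (auto simp: cycles_graph_def)
    then have "adjacent G y (w i ! Suc j)" using fw adjw by simp
    then show "y \<in> vertices G" by (rule adj_V)
  qed
  moreover have "\<forall>e\<in>edges (cycles_graph k q). f ` e \<in> edges G"
  proof
    fix e assume "e \<in> edges (cycles_graph k q)"
    then obtain i j where ij: "i < k" "j < q" "e = {cyc_vertex i j, cyc_vertex i (Suc j mod q)}"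
      by (auto simp: cycles_graph_def)
    then have "f ` e = {w i ! j, w i ! Suc j}" using fw fw' by simp
    then show "f ` e \<in> edges G" using adjw[OF ij(1,2)] by (simp add: adjacent_def)
  qed
  ultimately show ?thesis unfolding contains_subgraph_def by blast
qed

section \<open>The Turan family\<close>

lemma bip_edges_commute: "bip_edges A B = bip_edges B A"
  unfolding bip_edges_def by (auto simp: insert_commute)

lemma bip_edges_image: "(\<lambda>e. f ` e) ` bip_edges A B = bip_edges (f ` A) (f ` B)"
proof
  show "(\<lambda>e. f ` e) ` bip_edges A B \<subseteq> bip_edges (f ` A) (f ` B)"
    unfolding bip_edges_def by auto
  show "bip_edges (f ` A) (f ` B) \<subseteq> (\<lambda>e. f ` e) ` bip_edges A B"
  proof
    fix e assume "e \<in> bip_edges (f ` A) (f ` B)"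
    then obtain a b where "a \<in> A" "b \<in> B" "e = f ` {a, b}" unfolding bip_edges_def by auto
    then show "e \<in> (\<lambda>e. f ` e) ` bip_edges A B" unfolding bip_edges_def by blast
  qed
qed

lemma card_bip_edges:
  assumes "finite X" "finite Y" "X \<inter> Y = {}"
  shows "card (bip_edges X Y) = card X * card Y"
proof -
  have "bip_edges X Y = (\<lambda>(a, b). {a, b}) ` (X \<times> Y)" unfolding bip_edges_def by auto
  moreover have "inj_on (\<lambda>(a, b). {a, b}) (X \<times> Y)"
    using assms(3) by (auto simp: inj_on_def doubleton_eq_iff)
  ultimately show ?thesis by (simp add: card_image card_cartesian_product)
qed

lemma turan_sides: "turan_left n \<inter> turan_right n = {}" "turan_left n \<subseteq> {..<n}" "turan_right n \<subseteq> {..<n}"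
  "finite (turan_left n)" "finite (turan_right n)"
  by (auto simp: turan_left_def turan_right_def)

lemma num_edges_turan2: "num_edges (turan2 n) = (n div 2) * (n - n div 2)"
  using card_bip_edges[OF turan_sides(4,5,1), of n]
  by (simp add: num_edges_def turan2_def turan_left_def turan_right_def)

text \<open>Any bijection that respects the two sides carries \<open>A\<close> and \<open>B\<close> into one class of the Turan graph.\<close>

lemma iso_turan_family:
  assumes V: "vertices G = P \<union> Q" "P \<inter> Q = {}" "finite (vertices G)" and E: "edges G = bip_edges P Q \<union> bip_edges A B"
    and AB: "A \<union> B \<subseteq> P \<or> A \<union> B \<subseteq> Q" "A \<inter> B = {}" "card A = k - 1" "card B = k - 1"
    and cP: "card P = n div 2" and cQ: "card Q = n - n div 2"
  shows "\<exists>F\<in>turan_family n k. graph_iso G F"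
proof -
  have fin: "finite P" "finite Q" using V by auto
  obtain g where g: "bij_betw g P (turan_left n)"
    using finite_same_card_bij[OF fin(1), of "turan_left n"] cP by (auto simp: turan_left_def)
  obtain h where h: "bij_betw h Q (turan_right n)"
    using finite_same_card_bij[OF fin(2), of "turan_right n"] cQ by (auto simp: turan_right_def)
  define f where "f x = (if x \<in> P then g x else h x)" for x
  have fP: "bij_betw f P (turan_left n)"
    using g by (rule bij_betw_cong[THEN iffD1, rotated]) (simp add: f_def)
  have fQ: "bij_betw f Q (turan_right n)"
    using h by (rule bij_betw_cong[THEN iffD1, rotated]) (use V(2) in \<open>auto simp: f_def\<close>)
  have bij: "bij_betw f (P \<union> Q) (turan_left n \<union> turan_right n)"
    using fP fQ by (rule bij_betw_combine) (auto simp: turan_left_def turan_right_def)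
  have im: "f ` P = turan_left n" "f ` Q = turan_right n" using fP fQ by (auto simp: bij_betw_def)
  have inj: "inj_on f (P \<union> Q)" using bij by (simp add: bij_betw_def)
  have sub: "A \<subseteq> P \<union> Q" "B \<subseteq> P \<union> Q" using AB(1) by auto
  define F where "F = (vertices (turan2 n), edges (turan2 n) \<union> bip_edges (f ` A) (f ` B))"
  have "F \<in> turan_family n k"
    unfolding turan_family_def F_def mem_Collect_eq
  proof (intro exI conjI)
    show "f ` A \<union> f ` B \<subseteq> turan_left n \<or> f ` A \<union> f ` B \<subseteq> turan_right n"
      using AB(1) im by (auto simp flip: im)
    show "f ` A \<inter> f ` B = {}" using inj_on_image_Int[OF inj sub] AB(2) by simp
    show "card (f ` A) = k - 1" using card_image[OF inj_on_subset[OF inj sub(1)]] AB(3) by simp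
    show "card (f ` B) = k - 1" using card_image[OF inj_on_subset[OF inj sub(2)]] AB(4) by simp
  qed (rule refl)
  moreover have "graph_iso G F"
    unfolding graph_iso_def
  proof (intro exI conjI)
    show "bij_betw f (vertices G) (vertices F)" using bij V(1) by (simp add: F_def turan2_def)
    show "(\<lambda>e. f ` e) ` edges G = edges F"
      unfolding E image_Un bip_edges_image im by (simp add: F_def turan2_def)
  qed
  ultimately show ?thesis by blast
qed

text \<open>If \<open>s\<close> alternated along the cycle, then it would agree at positions \<open>0\<close> and \<open>q - 1\<close>, which are adjacent.\<close>

lemma odd_cycle_monochromatic_edge:
  fixes s :: "nat \<Rightarrow> bool"
  assumes "odd q"
  shows "\<exists>j<q. s j = s (Suc j mod q)"
proof (rule ccontr)
  assume "\<not> ?thesis"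
  then have alt: "s (Suc j mod q) \<longleftrightarrow> \<not> s j" if "j < q" for j using that by blast
  have parity: "j < q \<Longrightarrow> s j \<longleftrightarrow> (s 0 \<longleftrightarrow> even j)" for j
  proof (induction j)
    case (Suc j)
    then show ?case using alt[of j] by simp
  qed simp
  obtain m where m: "q = Suc m" using assms by (cases q) auto
  have "even m" using assms m by simp
  then have "s m \<longleftrightarrow> s 0" using parity[of m] m by blast
  moreover have "s 0 \<longleftrightarrow> \<not> s m" using alt[of m] by (simp add: m)
  ultimately show False by blast
qed

lemma turan_familyE:
  assumes "F \<in> turan_family n k"
  obtains A B where "vertices F = {..<n}"
    "edges F = bip_edges (turan_left n) (turan_right n) \<union> bip_edges A B"
    "A \<union> B \<subseteq> turan_left n \<or> A \<union> B \<subseteq> turan_right n" "A \<inter> B = {}" "card A = k - 1" "card B = k - 1"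
    "finite A" "finite B"
proof -
  obtain A B where F: "F = (vertices (turan2 n), edges (turan2 n) \<union> bip_edges A B)"
    and AB: "A \<union> B \<subseteq> turan_left n \<or> A \<union> B \<subseteq> turan_right n" "A \<inter> B = {}" "card A = k - 1" "card B = k - 1"
    using assms unfolding turan_family_def by blast
  have "turan_left n \<union> turan_right n = {..<n}" by (auto simp: turan_left_def turan_right_def)
  then have "vertices F = {..<n}" "edges F = bip_edges (turan_left n) (turan_right n) \<union> bip_edges A B"
    by (simp_all add: F turan2_def)
  moreover have "finite (A \<union> B)"
    using AB(1) finite_subset[of "A \<union> B"] by (auto simp: turan_left_def turan_right_def)
  ultimately show ?thesis using that AB by simp
qed

lemma simple_graph_turan_family:
  assumes "F \<in> turan_family n k"
  shows "simple_graph F"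
proof -
  obtain A B where F: "vertices F = {..<n}"
    "edges F = bip_edges (turan_left n) (turan_right n) \<union> bip_edges A B"
    "A \<union> B \<subseteq> turan_left n \<or> A \<union> B \<subseteq> turan_right n" "A \<inter> B = {}"
    using turan_familyE[OF assms] by metis
  have AB: "A \<subseteq> {..<n}" "B \<subseteq> {..<n}" using F(3) turan_sides by blast+
  have "e \<subseteq> {..<n} \<and> card e = 2" if XY: "X \<subseteq> {..<n}" "Y \<subseteq> {..<n}" "X \<inter> Y = {}" "e \<in> bip_edges X Y" for X Y e
  proof -
    obtain x y where "e = {x, y}" "x \<in> X" "y \<in> Y" using XY(4) unfolding bip_edges_def by blast
    moreover from this have "x \<noteq> y" using XY(3) by blast
    ultimately show ?thesis using XY by auto
  qed
  note bip = this
  show ?thesis unfolding simple_graph_def F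
  proof (intro conjI ballI)
    fix e assume "e \<in> bip_edges (turan_left n) (turan_right n) \<union> bip_edges A B"
    then have *: "e \<subseteq> {..<n} \<and> card e = 2"
    proof
      assume "e \<in> bip_edges (turan_left n) (turan_right n)"
      then show ?thesis by (rule bip[OF turan_sides(2,3,1)])
    next
      assume "e \<in> bip_edges A B"
      then show ?thesis by (rule bip[OF AB F(4)])
    qed
    show "e \<subseteq> {..<n}" "card e = 2" using * by auto
  qed simp
qed

lemma num_edges_turan_family:
  assumes "F \<in> turan_family n k"
  shows "num_edges F = num_edges (turan2 n) + (k - 1)\<^sup>2"
proof -
  obtain A B where F: "edges F = bip_edges (turan_left n) (turan_right n) \<union> bip_edges A B"
    and side: "A \<union> B \<subseteq> turan_left n \<or> A \<union> B \<subseteq> turan_right n" and dis: "A \<inter> B = {}"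
    and c: "card A = k - 1" "card B = k - 1" and f: "finite A" "finite B"
    using turan_familyE[OF assms] by metis
  have "bip_edges (turan_left n) (turan_right n) \<inter> bip_edges A B = {}"
  proof -
    have False if e: "e \<in> bip_edges (turan_left n) (turan_right n)" "e \<in> bip_edges A B" for e
    proof -
      obtain l r where lr: "e = {l, r}" "l \<in> turan_left n" "r \<in> turan_right n"
        using e(1) unfolding bip_edges_def by blast
      have "e \<subseteq> A \<union> B" using e(2) unfolding bip_edges_def by blast
      then have "e \<subseteq> turan_left n \<or> e \<subseteq> turan_right n" using side by blast
      then show False using lr turan_sides(1)[of n] by blast
    qed
    then show ?thesis by blast
  qed
  moreover have fin: "finite (bip_edges X Y)" if "finite X" "finite Y" for X Y :: "nat set"
  proof -
    have "bip_edges X Y \<subseteq> Pow (X \<union> Y)" unfolding bip_edges_def by auto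
    then show ?thesis using that finite_subset by (metis finite_Pow_iff finite_Un)
  qed
  ultimately have "num_edges F = card (bip_edges (turan_left n) (turan_right n)) + card (bip_edges A B)"
    unfolding num_edges_def F using turan_sides f by (intro card_Un_disjoint) auto
  then show ?thesis using card_bip_edges[OF f dis] c
    by (simp add: num_edges_def turan2_def power2_eq_square)
qed

text \<open>Each cycle uses an inner edge, hence a vertex of \<open>A\<close> and one of \<open>B\<close>. The centre lies outside one of
  these two sets, say \<open>S\<close>, and then the \<open>k\<close> cycles meet \<open>S\<close> in distinct vertices although \<open>S\<close> has only
  \<open>k - 1\<close>.\<close>

lemma turan_family_free:
  assumes FF: "F \<in> turan_family n k" and k: "1 \<le> k" and q: "odd q"
  shows "graph_free (cycles_graph k q) F"
  unfolding graph_free_def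
proof
  obtain A B where F: "edges F = bip_edges (turan_left n) (turan_right n) \<union> bip_edges A B"
    and dis: "A \<inter> B = {}" and c: "card A = k - 1" "card B = k - 1" and fin: "finite A" "finite B"
    using turan_familyE[OF FF] by metis
  assume "contains_subgraph F (cycles_graph k q)"
  then obtain f where inj: "inj_on f (vertices (cycles_graph k q))"
    and ed: "\<And>e. e \<in> edges (cycles_graph k q) \<Longrightarrow> f ` e \<in> edges F"
    unfolding contains_subgraph_def by blast
  have q0: "0 < q" using q by (cases q) auto
  have vert: "cyc_vertex i j \<in> vertices (cycles_graph k q)" if "i < k" "j < q" for i j
    using that by (auto simp: cycles_graph_def)
  have inner: "\<exists>a\<in>A. \<exists>b\<in>B. (\<exists>j<q. a = f (cyc_vertex i j)) \<and> (\<exists>j<q. b = f (cyc_vertex i j))" if i: "i < k" for i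
  proof -
    obtain j where j: "j < q" "f (cyc_vertex i j) \<in> turan_left n \<longleftrightarrow> f (cyc_vertex i (Suc j mod q)) \<in> turan_left n"
      using odd_cycle_monochromatic_edge[OF q, of "\<lambda>j. f (cyc_vertex i j) \<in> turan_left n"] by blast
    define x y where "x = f (cyc_vertex i j)" and "y = f (cyc_vertex i (Suc j mod q))"
    have "{cyc_vertex i j, cyc_vertex i (Suc j mod q)} \<in> edges (cycles_graph k q)"
      unfolding cycles_graph_def snd_conv using i j(1) by blast
    from ed[OF this] have "{x, y} \<in> edges F" by (simp add: x_def y_def)
    moreover have "{x, y} \<notin> bip_edges (turan_left n) (turan_right n)"
    proof
      assume "{x, y} \<in> bip_edges (turan_left n) (turan_right n)"
      then obtain l r where "{x, y} = {l, r}" "l \<in> turan_left n" "r \<in> turan_right n"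
        unfolding bip_edges_def by blast
      then show False using j(2) turan_sides(1)[of n] unfolding x_def[symmetric] y_def[symmetric]
        by (auto simp: doubleton_eq_iff)
    qed
    ultimately have "{x, y} \<in> bip_edges A B" unfolding F by blast
    then obtain a b where "{x, y} = {a, b}" "a \<in> A" "b \<in> B" unfolding bip_edges_def by blast
    then have "x \<in> A \<and> y \<in> B \<or> y \<in> A \<and> x \<in> B" by (auto simp: doubleton_eq_iff)
    moreover have "Suc j mod q < q" using q0 by simp
    ultimately show ?thesis using j(1) unfolding x_def y_def by blast
  qed
  \<comment> \<open>The cycles meet a set that avoids the centre in distinct vertices.\<close>
  have no: False if S: "finite S" "card S = k - 1" "f (0, 0) \<notin> S" and hit: "\<And>i. i < k \<Longrightarrow> \<exists>j<q. f (cyc_vertex i j) \<in> S" for S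
  proof -
    obtain h where h: "\<And>i. i < k \<Longrightarrow> h i < q \<and> f (cyc_vertex i (h i)) \<in> S" using hit by metis
    have pos: "h i \<noteq> 0" if "i < k" for i
      using h[OF that] S(3) by (intro notI) (simp add: cyc_vertex_def)
    have "inj_on (\<lambda>i. f (cyc_vertex i (h i))) {..<k}"
    proof (rule inj_onI)
      fix i j assume ij: "i \<in> {..<k}" "j \<in> {..<k}" and eq: "f (cyc_vertex i (h i)) = f (cyc_vertex j (h j))"
      then have "cyc_vertex i (h i) = cyc_vertex j (h j)"
        using inj_onD[OF inj eq] vert h by simp
      then show "i = j" using pos[of i] pos[of j] ij by (simp add: cyc_vertex_def)
    qed
    moreover have "(\<lambda>i. f (cyc_vertex i (h i))) ` {..<k} \<subseteq> S" using h by auto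
    ultimately have "card {..<k} \<le> card S" using S(1) by (rule card_inj_on_le)
    then show False using S(2) k by simp
  qed
  show False
  proof (cases "f (0, 0) \<in> A")
    case True
    then have "f (0, 0) \<notin> B" using dis by blast
    then show False using no[OF fin(2) c(2)] inner by blast
  next
    case False
    then show False using no[OF fin(1) c(1)] inner by blast
  qed
qed

lemma turan_family_nonempty:
  assumes "4 * k \<le> n"
  shows "turan_family n k \<noteq> {}"
proof -
  define A B where "A = {..<k - 1}" and "B = {k - 1..<2 * (k - 1)}"
  have "A \<union> B \<subseteq> turan_left n" using assms by (auto simp: A_def B_def turan_left_def)
  moreover have "A \<inter> B = {}" "card A = k - 1" "card B = k - 1" by (auto simp: A_def B_def)
  ultimately show ?thesis unfolding turan_family_def by blast
qed

lemma num_edges_iso: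
  assumes "graph_iso G F" "simple_graph G"
  shows "num_edges G = num_edges F"
proof -
  obtain f where f: "bij_betw f (vertices G) (vertices F)" "(\<lambda>e. f ` e) ` edges G = edges F"
    using assms(1) unfolding graph_iso_def by blast
  have "edges G \<subseteq> Pow (vertices G)" using assms(2) by (auto simp: simple_graph_def)
  then have "inj_on (\<lambda>e. f ` e) (edges G)"
    using inj_on_image_Pow[OF bij_betw_imp_inj_on[OF f(1)]] inj_on_subset by blast
  then show ?thesis using f(2) card_image unfolding num_edges_def by metis
qed

lemma graph_free_iso:
  assumes iso: "graph_iso G F" and free: "graph_free H F"
  shows "graph_free H G"
  unfolding graph_free_def
proof
  obtain f where f: "bij_betw f (vertices G) (vertices F)" "(\<lambda>e. f ` e) ` edges G = edges F"
    using iso unfolding graph_iso_def by blast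
  assume "contains_subgraph G H"
  then obtain h where h: "inj_on h (vertices H)" "h ` vertices H \<subseteq> vertices G"
    "\<forall>e\<in>edges H. h ` e \<in> edges G" unfolding contains_subgraph_def by blast
  have "inj_on (f \<circ> h) (vertices H)"
    using h f(1) by (intro comp_inj_on) (auto simp: bij_betw_def intro: inj_on_subset)
  moreover have "(f \<circ> h) ` vertices H \<subseteq> vertices F" using h(2) f(1) by (auto simp: bij_betw_def)
  moreover have "\<forall>e\<in>edges H. (f \<circ> h) ` e \<in> edges F"
  proof
    fix e assume "e \<in> edges H"
    then have "f ` (h ` e) \<in> edges F" using h(3) f(2) by blast
    then show "(f \<circ> h) ` e \<in> edges F" by (simp add: image_comp)
  qed
  ultimately have "contains_subgraph F H" unfolding contains_subgraph_def by blast
  then show False using free by (simp add: graph_free_def)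
qed

lemma card_vertices_turan_family: "F \<in> turan_family n k \<Longrightarrow> card (vertices F) = n"
  by (metis turan_familyE card_lessThan)

section \<open>Extremal graphs with large minimum degree\<close>

context ugraph
begin

text \<open>The bridge between routing and counting. Which side contains \<open>v\<close> does not matter, since the
  condition of being linked is symmetric.\<close>

lemma star_matching_bounded_linked:
  assumes VPQ: "V = P \<union> Q" "P \<inter> Q = {}" and lk: "linked P Q L"
    and L: "(D + 1) * q + q + 4 \<le> L" and q: "5 \<le> q" "odd q" and no_flower: "\<not> flower (D + 1) q"
  shows "cut_graph.star_matching_bounded V adj P D"
proof -
  interpret cut: cut_graph V adj P Q D
    using VPQ by unfold_locales
  show ?thesis unfolding cut.star_matching_bounded_def
  proof (intro ballI allI impI)
    fix v M assume v: "v \<in> V" and M: "cut.usable_matching v M"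
    show "card (cut.inner v) + card M \<le> D"
    proof (rule ccontr)
      assume "\<not> card (cut.inner v) + card M \<le> D"
      then have k: "D + 1 \<le> card (cut.inner v) + card M" by simp
      have finM: "finite M" "pairwise disjnt M"
        using cut.usable_matching_finite[OF M] M by (auto simp: cut.usable_matching_def)
      have yV: "y \<in> V" if "adj x y" for x y using adj_V[OF adj_sym[OF that]] .
      have "flower (D + 1) q"
      proof (cases "v \<in> P")
        case True
        show ?thesis
        proof (rule star_matching_flower[OF lk L q True _ finM _ k])
          show "cut.inner v \<subseteq> nbrs v \<inter> P" using True by (auto simp: cut.inner_def cut.same_def nbrs_def)
          fix e assume "e \<in> M"
          then obtain x y where e: "e = {x, y}" "adj x y" "cut.same x y"
            "e \<inter> insert v (cut.inner v) = {}" "cut.same v x \<or> adj v x" by (rule cut.usable_matchingD[OF M])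
          have "x \<in> P \<and> y \<in> P \<or> x \<in> Q \<and> y \<in> Q \<and> adj v x"
            using e(3,5) True adj_V[OF e(2)] yV[OF e(2)] VPQ unfolding cut.same_def by blast
          then show "\<exists>x y. e = {x, y} \<and> adj x y \<and> v \<notin> e \<and> e \<inter> cut.inner v = {} \<and>
             (x \<in> P \<and> y \<in> P \<or> x \<in> Q \<and> y \<in> Q \<and> adj v x)"
            using e by (intro exI[of _ x] exI[of _ y]) auto
        qed
      next
        case False
        then have vQ: "v \<in> Q" using v VPQ by auto
        show ?thesis
        proof (rule star_matching_flower[OF linked_sym[OF lk] L q vQ _ finM _ k])
          show "cut.inner v \<subseteq> nbrs v \<inter> Q"
            using False yV VPQ by (auto simp: cut.inner_def cut.same_def nbrs_def)
          fix e assume "e \<in> M"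
          then obtain x y where e: "e = {x, y}" "adj x y" "cut.same x y"
            "e \<inter> insert v (cut.inner v) = {}" "cut.same v x \<or> adj v x" by (rule cut.usable_matchingD[OF M])
          have "x \<in> Q \<and> y \<in> Q \<or> x \<in> P \<and> y \<in> P \<and> adj v x"
            using e(3,5) False adj_V[OF e(2)] yV[OF e(2)] VPQ unfolding cut.same_def by blast
          then show "\<exists>x y. e = {x, y} \<and> adj x y \<and> v \<notin> e \<and> e \<inter> cut.inner v = {} \<and>
             (x \<in> Q \<and> y \<in> Q \<or> x \<in> P \<and> y \<in> P \<and> adj v x)"
            using e by (intro exI[of _ x] exI[of _ y]) auto
        qed
      qed
      with no_flower show False ..
    qed
  qed
qed

end

text \<open>The order from which \<open>linked_partition\<close> applies with room for forbidden sets of \<open>k * q\<close> vertices,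
  that is, with \<open>L = k * q + q + 4\<close>.\<close>

definition order_threshold :: "nat \<Rightarrow> nat \<Rightarrow> nat" where
  "order_threshold k q = 128 * (k * q + q + 4) * 2 ^ (128 * (k * q + q + 4)) + 4"

text \<open>The surplus of the linked partition bounds the number of edges; when the bound is attained, the
  partition is balanced as well, and the structure of \<open>surplus_extremal\<close> can be read off.\<close>

lemma min_degree_case:
  assumes k: "2 \<le> k" and q: "5 \<le> q" "odd q"
    and G: "simple_graph G" and free: "graph_free (cycles_graph k q) G"
    and n: "card (vertices G) = n" and big: "order_threshold k q \<le> n"
    and deg: "\<And>v. v \<in> vertices G \<Longrightarrow> n div 2 \<le> degree G v"
  shows "num_edges G \<le> num_edges (turan2 n) + (k - 1)\<^sup>2 \<and>
     (num_edges G = num_edges (turan2 n) + (k - 1)\<^sup>2 \<longrightarrow> (\<exists>F\<in>turan_family n k. graph_iso G F))"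
proof -
  interpret ugraph "vertices G" "adjacent G" using simple_graph_ugraph[OF G] .
  define L where "L = k * q + q + 4"
  define D where "D = k - 1"
  have kD: "k = D + 1" and D1: "1 \<le> D" using k by (auto simp: D_def)
  have deg_nbrs: "degree G v = card (nbrs v)" for v by (simp add: degree_def nbrs_def)
  have no: "\<not> flower k q"
    using flower_contains_cycles[OF G, of k q] k q free by (auto simp: graph_free_def)
  obtain P Q where PQ: "vertices G = P \<union> Q" "P \<inter> Q = {}" and lk: "linked P Q L"
    using linked_partition[of k q L] k q no deg big
    unfolding n deg_nbrs order_threshold_def L_def by auto
  interpret cut: cut_graph "vertices G" "adjacent G" P Q D
    using PQ by unfold_locales
  have bnd: "cut.star_matching_bounded"
    using star_matching_bounded_linked[OF PQ lk _ q] no unfolding L_def kD by simp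
  have fin: "finite P" "finite Q" using PQ finite_V by auto
  have n': "card P + card Q = n" using n PQ fin by (simp add: card_Un_disjoint)
  have twice: "2 * int (num_edges G) = 2 * int (card P * card Q) + cut.surplus"
    using handshake[OF G] cut.degree_sum_surplus unfolding deg_nbrs by linarith
  have sur: "cut.surplus \<le> 2 * (int D)\<^sup>2" by (rule cut.surplus_le[OF bnd])
  have prod: "card P * card Q \<le> num_edges (turan2 n)"
    using half_product_max(1)[of "card P" "card Q"] unfolding n' num_edges_turan2 .
  have sq: "int (D\<^sup>2) = (int D)\<^sup>2" by simp
  have upper: "num_edges G \<le> num_edges (turan2 n) + D\<^sup>2"
    using twice sur prod sq by linarith
  have "\<exists>F\<in>turan_family n k. graph_iso G F" if eq: "num_edges G = num_edges (turan2 n) + D\<^sup>2"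
  proof -
    have sur2: "cut.surplus = 2 * (int D)\<^sup>2" and prod2: "card P * card Q = num_edges (turan2 n)"
      using twice sur prod sq eq by linarith+
    obtain A B where AB: "A \<inter> B = {}" "card A = D" "card B = D" "A \<union> B \<subseteq> P \<or> A \<union> B \<subseteq> Q"
      and adjAB: "\<forall>x\<in>vertices G. \<forall>y\<in>vertices G.
        adjacent G x y \<longleftrightarrow> \<not> cut.same x y \<or> x \<in> A \<and> y \<in> B \<or> x \<in> B \<and> y \<in> A"
      using cut.surplus_extremal[OF bnd sur2 D1] by blast
    have ABV: "A \<subseteq> vertices G" "B \<subseteq> vertices G" using AB(4) PQ by auto
    have E: "edges G = bip_edges P Q \<union> bip_edges A B"
    proof
      show "edges G \<subseteq> bip_edges P Q \<union> bip_edges A B"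
      proof
        fix e assume "e \<in> edges G"
        then obtain x y where e: "e = {x, y}" "adjacent G x y" by (rule edge_pairE[OF G])
        have xy: "x \<in> vertices G" "y \<in> vertices G" using adj_V[OF e(2)] adj_V[OF adj_sym[OF e(2)]] .
        have yx: "e = {y, x}" using e by auto
        consider "x \<in> P" "y \<in> Q" | "y \<in> P" "x \<in> Q" | "x \<in> A" "y \<in> B" | "x \<in> B" "y \<in> A"
          using adjAB xy e(2) PQ unfolding cut.same_def by blast
        then show "e \<in> bip_edges P Q \<union> bip_edges A B"
          using e(1) yx unfolding bip_edges_def by cases blast+
      qed
      show "bip_edges P Q \<union> bip_edges A B \<subseteq> edges G"
      proof
        fix e assume "e \<in> bip_edges P Q \<union> bip_edges A B"
        then consider x y where "e = {x, y}" "x \<in> P" "y \<in> Q" | x y where "e = {x, y}" "x \<in> A" "y \<in> B"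
          unfolding bip_edges_def by blast
        then show "e \<in> edges G"
        proof cases
          case 1
          then have "adjacent G x y" using adjAB PQ unfolding cut.same_def by blast
          then show ?thesis using 1 by (simp add: adjacent_def)
        next
          case 2
          then have "adjacent G x y" using adjAB ABV by blast
          then show ?thesis using 2 by (simp add: adjacent_def)
        qed
      qed
    qed
    have "card P = n div 2 \<or> card Q = n div 2"
      using half_product_max(2)[of "card P" "card Q"] prod2 unfolding n' num_edges_turan2 by blast
    then show ?thesis
    proof
      assume "card P = n div 2"
      then show ?thesis
        using n' AB by (intro iso_turan_family[OF PQ finite_V E]) (auto simp: D_def)
    next
      assume "card Q = n div 2"
      then show ?thesis
        using n' AB PQ finite_V E[unfolded bip_edges_commute[of P Q]]
        by (intro iso_turan_family[of G Q P A B]) (auto simp: D_def)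
    qed
  qed
  then show ?thesis using upper unfolding D_def by blast
qed

section \<open>Deleting vertices of low degree\<close>

definition delete_vertex :: "'a graph \<Rightarrow> 'a \<Rightarrow> 'a graph" where
  "delete_vertex G v = (vertices G - {v}, {e\<in>edges G. v \<notin> e})"

lemma simple_graph_delete_vertex: "simple_graph G \<Longrightarrow> simple_graph (delete_vertex G v)"
  unfolding simple_graph_def delete_vertex_def by auto

lemma graph_free_delete_vertex:
  assumes "graph_free H G"
  shows "graph_free H (delete_vertex G v)"
  unfolding graph_free_def
proof
  assume "contains_subgraph (delete_vertex G v) H"
  then obtain f where f: "inj_on f (vertices H)" "f ` vertices H \<subseteq> vertices G - {v}"
    "\<forall>e\<in>edges H. f ` e \<in> {e\<in>edges G. v \<notin> e}"
    unfolding contains_subgraph_def delete_vertex_def fst_conv snd_conv by (elim exE conjE)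
  then have "contains_subgraph G H" unfolding contains_subgraph_def by blast
  then show False using assms by (simp add: graph_free_def)
qed

lemma num_edges_delete_vertex:
  assumes G: "simple_graph G"
  shows "num_edges G = num_edges (delete_vertex G v) + degree G v"
proof -
  have "edges G = {e\<in>edges G. v \<notin> e} \<union> {e\<in>edges G. v \<in> e}" by auto
  then have "card (edges G) = card ({e\<in>edges G. v \<notin> e} \<union> {e\<in>edges G. v \<in> e})" by simp
  also have "\<dots> = card {e\<in>edges G. v \<notin> e} + card {e\<in>edges G. v \<in> e}"
    using finite_edges[OF G] by (intro card_Un_disjoint) auto
  finally show ?thesis using card_incident_edges[OF G, of v] by (simp add: num_edges_def delete_vertex_def)
qed

lemma num_edges_le_square:
  assumes G: "simple_graph G"
  shows "num_edges G \<le> card (vertices G) * card (vertices G)"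
proof -
  interpret ugraph "vertices G" "adjacent G" using simple_graph_ugraph[OF G] .
  have "degree G v \<le> card (vertices G)" for v
    using card_mono[OF finite_V nbrs_subset[of v]] by (simp add: degree_def nbrs_def)
  then have "(\<Sum>v\<in>vertices G. degree G v) \<le> (\<Sum>v\<in>vertices G. card (vertices G))"
    by (intro sum_mono)
  then show ?thesis using handshake[OF G] by simp
qed

lemma num_edges_turan2_Suc: "num_edges (turan2 (Suc n)) = num_edges (turan2 n) + Suc n div 2"
proof (cases "even n")
  case True
  then obtain m where "n = 2 * m" by blast
  then show ?thesis by (simp add: num_edges_turan2)
next
  case False
  then obtain m where "n = 2 * m + 1" by (blast elim: oddE)
  moreover have "Suc (2 * m + 1) div 2 = m + 1" "(2 * m + 1) div 2 = m" by auto
  ultimately show ?thesis by (simp add: num_edges_turan2 algebra_simps)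
qed

text \<open>As long as the minimum degree is too small, deleting a vertex gains one edge on the Turan number. The
  truncated difference is the largest excess that can still be present at order \<open>n\<close>: at order \<open>n0\<close>
  it is the trivial bound \<open>n0 * n0\<close>, and it vanishes once \<open>n\<close> reaches \<open>n0 + n0 * n0\<close>.\<close>

lemma bound_from_min_degree_case:
  fixes H :: "'b graph" and G :: "'a graph"
  assumes dense: "\<And>G :: 'a graph. \<lbrakk>simple_graph G; graph_free H G; n0 \<le> card (vertices G);
        \<And>v. v \<in> vertices G \<Longrightarrow> card (vertices G) div 2 \<le> degree G v\<rbrakk>
      \<Longrightarrow> num_edges G \<le> num_edges (turan2 (card (vertices G))) + c"
    and n: "n0 \<le> n" and G: "simple_graph G" "graph_free H G" "card (vertices G) = n"
  shows "num_edges G \<le> num_edges (turan2 n) + c + (n0 * n0 - (n - n0))"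
  using n G
proof (induction n arbitrary: G rule: dec_induct)
  case base
  then show ?case using num_edges_le_square[OF base(1)] by simp
next
  case (step n)
  show ?case
  proof (cases "\<forall>v\<in>vertices G. Suc n div 2 \<le> degree G v")
    case True
    then show ?thesis using dense[of G] step by fastforce
  next
    case False
    then obtain v where v: "v \<in> vertices G" "degree G v < Suc n div 2" by auto
    have "card (vertices (delete_vertex G v)) = n" using v(1) step.prems(3) by (simp add: delete_vertex_def)
    then have "num_edges (delete_vertex G v) \<le> num_edges (turan2 n) + c + (n0 * n0 - (n - n0))"
      using step.IH simple_graph_delete_vertex[OF step.prems(1)] graph_free_delete_vertex[OF step.prems(2)]
      by blast
    then show ?thesis
      using v(2) num_edges_delete_vertex[OF step.prems(1), of v] num_edges_turan2_Suc[of n] step.hyps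
      by linarith
  qed
qed

text \<open>If a vertex had degree below \<open>n div 2\<close> in a graph attaining the bound, then deleting it would leave a
  graph that exceeds the bound for order \<open>n - 1\<close>.\<close>

lemma upper_bound:
  assumes k: "2 \<le> k" and q: "5 \<le> q" "odd q" and n0: "n0 = order_threshold k q"
    and n: "n0 + n0 * n0 < n"
    and G: "simple_graph G" "graph_free (cycles_graph k q) G" "card (vertices G) = n"
  shows "num_edges G \<le> num_edges (turan2 n) + (k - 1)\<^sup>2"
    and "num_edges G = num_edges (turan2 n) + (k - 1)\<^sup>2 \<Longrightarrow> \<exists>F\<in>turan_family n k. graph_iso G F"
proof -
  have dense: "num_edges G \<le> num_edges (turan2 (card (vertices G))) + (k - 1)\<^sup>2"
    if "simple_graph G" "graph_free (cycles_graph k q) G" "n0 \<le> card (vertices G)"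
      "\<And>v. v \<in> vertices G \<Longrightarrow> card (vertices G) div 2 \<le> degree G v" for G :: "'a graph"
    using min_degree_case[OF k q that(1,2) refl _ that(4)] that(3) n0 by blast
  note bound = bound_from_min_degree_case[of "cycles_graph k q" n0 "(k - 1)\<^sup>2", OF dense]
  show "num_edges G \<le> num_edges (turan2 n) + (k - 1)\<^sup>2"
    using bound[of n G] n G by fastforce
  show "\<exists>F\<in>turan_family n k. graph_iso G F" if eq: "num_edges G = num_edges (turan2 n) + (k - 1)\<^sup>2"
  proof (cases "\<forall>v\<in>vertices G. n div 2 \<le> degree G v")
    case True
    then show ?thesis using min_degree_case[OF k q G] n n0 eq by auto
  next
    case False
    then obtain v where v: "v \<in> vertices G" "degree G v < n div 2" by auto
    obtain m where m: "n = Suc m" using n by (cases n) auto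
    have "card (vertices (delete_vertex G v)) = m" using v(1) G(3) m by (simp add: delete_vertex_def)
    then have "num_edges (delete_vertex G v) \<le> num_edges (turan2 m) + (k - 1)\<^sup>2 + (n0 * n0 - (m - n0))"
      using bound[of m "delete_vertex G v"] simple_graph_delete_vertex[OF G(1)]
        graph_free_delete_vertex[OF G(2)] n m by fastforce
    moreover have "n0 * n0 - (m - n0) = 0" using n m by linarith
    ultimately have "num_edges G < num_edges (turan2 n) + (k - 1)\<^sup>2"
      using v(2) num_edges_delete_vertex[OF G(1), of v] num_edges_turan2_Suc[of m]
      unfolding m by linarith
    then show ?thesis using eq by simp
  qed
qed

section \<open>The extremal number and the extremal graphs\<close>

lemma ex_number_cycles:
  assumes k: "2 \<le> k" and q: "5 \<le> q" "odd q"
    and n: "order_threshold k q + order_threshold k q * order_threshold k q < n" "4 * k \<le> n"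
  shows "ex_number n (cycles_graph k q) = num_edges (turan2 n) + (k - 1)\<^sup>2"
  unfolding ex_number_def
proof (rule Max_eqI)
  let ?S = "{num_edges G | G :: nat graph. simple_graph G \<and> card (vertices G) = n \<and> graph_free (cycles_graph k q) G}"
  show le: "x \<le> num_edges (turan2 n) + (k - 1)\<^sup>2" if "x \<in> ?S" for x
    using that upper_bound(1)[OF k q refl n(1)] by blast
  then show "finite ?S" by (meson finite_atMost finite_subset atMost_iff subsetI)
  obtain F where F: "F \<in> turan_family n k" using turan_family_nonempty[OF n(2)] by blast
  have "graph_free (cycles_graph k q) F" using turan_family_free[OF F _ q(2)] k by simp
  then show "num_edges (turan2 n) + (k - 1)\<^sup>2 \<in> ?S"
    using simple_graph_turan_family[OF F] card_vertices_turan_family[OF F] num_edges_turan_family[OF F]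
    unfolding mem_Collect_eq by (intro exI[of _ F]) simp
qed

theorem theorem1p2:
  fixes k q :: nat
  assumes "k \<ge> 2" and "q \<ge> 5" and "odd q"
  shows "\<exists>n1. \<forall>n\<ge>n1.
           ex_number n (cycles_graph k q) = num_edges (turan2 n) + (k - 1)\<^sup>2 \<and>
           (\<forall>G :: 'a graph. simple_graph G \<and> card (vertices G) = n \<longrightarrow>
              (extremal_graph n (cycles_graph k q) G \<longleftrightarrow>
               (\<exists>F\<in>turan_family n k. graph_iso G F)))"
proof -
  define n0 where "n0 = order_threshold k q"
  have "ex_number n (cycles_graph k q) = num_edges (turan2 n) + (k - 1)\<^sup>2 \<and>
     (\<forall>G :: 'a graph. simple_graph G \<and> card (vertices G) = n \<longrightarrow>
        (extremal_graph n (cycles_graph k q) G \<longleftrightarrow> (\<exists>F\<in>turan_family n k. graph_iso G F)))"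
    if "n0 + n0 * n0 + 4 * k + 1 \<le> n" for n
  proof (intro conjI allI impI)
    have n: "n0 + n0 * n0 < n" "4 * k \<le> n" using that by linarith+
    show ex: "ex_number n (cycles_graph k q) = num_edges (turan2 n) + (k - 1)\<^sup>2"
      using ex_number_cycles[OF assms] n unfolding n0_def by blast
    fix G :: "'a graph" assume G: "simple_graph G \<and> card (vertices G) = n"
    show "extremal_graph n (cycles_graph k q) G \<longleftrightarrow> (\<exists>F\<in>turan_family n k. graph_iso G F)"
    proof
      assume "extremal_graph n (cycles_graph k q) G"
      then show "\<exists>F\<in>turan_family n k. graph_iso G F"
        using upper_bound(2)[OF assms n0_def n(1), of G] G unfolding extremal_graph_def ex by blast
    next
      assume "\<exists>F\<in>turan_family n k. graph_iso G F"
      then obtain F where F: "F \<in> turan_family n k" "graph_iso G F" by blast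
      have "graph_free (cycles_graph k q) F" using turan_family_free[OF F(1) _ assms(3)] assms(1) by simp
      then show "extremal_graph n (cycles_graph k q) G"
        unfolding extremal_graph_def ex
        using G graph_free_iso[OF F(2)] num_edges_iso[OF F(2)] num_edges_turan_family[OF F(1)] by simp
    qed
  qed
  then show ?thesis by blast
qed

end
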